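(* Let $\mathbb{F}$ be an algebraically closed field. For any tensor $T\in\mathbb{F}^{n_1\times n_2\times n_3}$, \[ Q(T)\le \mathrm{GR}(T)\le \mathrm{SR}(T). \]
   Context: For $T\in\mathbb{F}^{n_1\times n_2\times n_3}$ write $T(x,y,z)=\sum_{i,j,k}T_{i,j,k}x_iy_jz_k$ and $T(x,y,\cdot)=(T(x,y,e_k))_k$. The geometric rank is $\mathrm{GR}(T)=\operatorname{codim}\{(x,y)\in\mathbb{F}^{n_1}\times\mathbb{F}^{n_2}: T(x,y,\cdot)=0\}$ ($n_1+n_2$ minus the dimension of this affine variety). For tensors $S,T$ write $S\le T$ if there are matrices $A,B,C$ with $S=(A,B,C)\cdot T:=(\sum_{a,b,c}A_{ia}B_{jb}C_{kc}T_{a,b,c})_{i,j,k}$. $I_s$ is the $s\times s\times s$ diagonal tensor with ones on the diagonal; the subrank is $Q(T)=\max\{s: I_s\le T\}$. The slice rank $\mathrm{SR}(T)$ is the smallest $r$ such that $T$ is a sum of $r$ tensors each of the form $(u_iV_{jk})_{i,j,k}$, $(u_jV_{ik})_{i,j,k}$ or $(u_kV_{ij})_{i,j,k}$ for a vector $u$ and a matrix $V$. *)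

theory Defs
  imports
    "HOL-Computational_Algebra.Polynomial"
    "Jordan_Normal_Form.Matrix"
begin

section \<open>Tensors\<close>

text \<open>
  An \<open>n1 \<times> n2 \<times> n3\<close> tensor is a function of three indices (counted from 0), of which only the
  entries \<open>T i j k\<close> with \<open>i < n1\<close>, \<open>j < n2\<close>, \<open>k < n3\<close> are meaningful; the dimensions are passed
  separately and no definition below reads an entry outside this range.
\<close>

type_synonym 'a tensor = "nat \<Rightarrow> nat \<Rightarrow> nat \<Rightarrow> 'a"

definition tensor_eq :: "nat \<Rightarrow> nat \<Rightarrow> nat \<Rightarrow> 'a tensor \<Rightarrow> 'a tensor \<Rightarrow> bool" where
  "tensor_eq n1 n2 n3 S T \<longleftrightarrow> (\<forall>i<n1. \<forall>j<n2. \<forall>k<n3. S i j k = T i j k)"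

definition tensor_eval ::
  "nat \<Rightarrow> nat \<Rightarrow> nat \<Rightarrow> 'a::comm_ring_1 tensor \<Rightarrow> 'a vec \<Rightarrow> 'a vec \<Rightarrow> 'a vec \<Rightarrow> 'a" where
  "tensor_eval n1 n2 n3 T x y z =
     (\<Sum>i<n1. \<Sum>j<n2. \<Sum>k<n3. T i j k * x $ i * y $ j * z $ k)"

text \<open>The vector \<open>T(x,y,\<cdot>)\<close>.\<close>

definition tensor_contract ::
  "nat \<Rightarrow> nat \<Rightarrow> nat \<Rightarrow> 'a::comm_ring_1 tensor \<Rightarrow> 'a vec \<Rightarrow> 'a vec \<Rightarrow> 'a vec" where
  "tensor_contract n1 n2 n3 T x y = vec n3 (\<lambda>k. tensor_eval n1 n2 n3 T x y (unit_vec n3 k))"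

section \<open>Dimension of affine varieties\<close>

text \<open>
  Polynomial functions on \<open>n\<close>-dimensional affine space, as functions on \<open>carrier_vec n\<close>. Zero loci
  depend only on the functions that polynomials induce, so formal polynomials are not needed.
\<close>

inductive_set poly_funs :: "nat \<Rightarrow> ('a::comm_ring_1 vec \<Rightarrow> 'a) set" for n :: nat where
  const: "(\<lambda>v. c) \<in> poly_funs n"
| coord: "i < n \<Longrightarrow> (\<lambda>v. v $ i) \<in> poly_funs n"
| add: "p \<in> poly_funs n \<Longrightarrow> q \<in> poly_funs n \<Longrightarrow> (\<lambda>v. p v + q v) \<in> poly_funs n"
| mult: "p \<in> poly_funs n \<Longrightarrow> q \<in> poly_funs n \<Longrightarrow> (\<lambda>v. p v * q v) \<in> poly_funs n"

definition affine_variety :: "nat \<Rightarrow> 'a::comm_ring_1 vec set \<Rightarrow> bool" where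
  "affine_variety n Z \<longleftrightarrow> (\<exists>P \<subseteq> poly_funs n. Z = {v \<in> carrier_vec n. \<forall>p\<in>P. p v = 0})"

definition irreducible_variety :: "nat \<Rightarrow> 'a::comm_ring_1 vec set \<Rightarrow> bool" where
  "irreducible_variety n Z \<longleftrightarrow> affine_variety n Z \<and> Z \<noteq> {} \<and>
     (\<forall>Z1 Z2. affine_variety n Z1 \<and> affine_variety n Z2 \<and> Z = Z1 \<union> Z2 \<longrightarrow> Z = Z1 \<or> Z = Z2)"

text \<open>
  The dimension of an affine variety \<open>X\<close> is the largest \<open>d\<close> such that there is a strictly increasing
  chain of irreducible subvarieties \<open>Z 0 \<subset> \<dots> \<subset> Z d\<close> of \<open>X\<close>. Over a field, \<open>d\<close> is bounded by \<open>n\<close>,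
  so for a nonempty variety the supremum is a maximum.
\<close>

definition variety_dim :: "nat \<Rightarrow> 'a::comm_ring_1 vec set \<Rightarrow> nat" where
  "variety_dim n X = Sup {d. \<exists>Z. (\<forall>i\<le>d. irreducible_variety n (Z i) \<and> Z i \<subseteq> X) \<and>
                                (\<forall>i<d. Z i \<subset> Z (Suc i))}"

section \<open>Geometric rank, subrank and slice rank\<close>

text \<open>A pair \<open>(x,y)\<close> is identified with the concatenated vector of dimension \<open>n1 + n2\<close>.\<close>

definition tensor_variety ::
  "nat \<Rightarrow> nat \<Rightarrow> nat \<Rightarrow> 'a::comm_ring_1 tensor \<Rightarrow> 'a vec set" where
  "tensor_variety n1 n2 n3 T =
     {x @\<^sub>v y | x y. x \<in> carrier_vec n1 \<and> y \<in> carrier_vec n2 \<and>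
                   tensor_contract n1 n2 n3 T x y = 0\<^sub>v n3}"

text \<open>Integer-valued, so that the subtraction is not truncated.\<close>

definition geometric_rank :: "nat \<Rightarrow> nat \<Rightarrow> nat \<Rightarrow> 'a::comm_ring_1 tensor \<Rightarrow> int" where
  "geometric_rank n1 n2 n3 T =
     int (n1 + n2) - int (variety_dim (n1 + n2) (tensor_variety n1 n2 n3 T))"

definition tensor_act ::
  "nat \<Rightarrow> nat \<Rightarrow> nat \<Rightarrow> 'a::comm_ring_1 mat \<Rightarrow> 'a mat \<Rightarrow> 'a mat \<Rightarrow> 'a tensor \<Rightarrow> 'a tensor" where
  "tensor_act n1 n2 n3 A B C T = (\<lambda>i j k.
     \<Sum>a<n1. \<Sum>b<n2. \<Sum>c<n3. A $$ (i,a) * B $$ (j,b) * C $$ (k,c) * T a b c)"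

text \<open>\<open>S \<le> T\<close>, for \<open>S\<close> of format \<open>m1 \<times> m2 \<times> m3\<close> and \<open>T\<close> of format \<open>n1 \<times> n2 \<times> n3\<close>.\<close>

definition tensor_le ::
  "nat \<Rightarrow> nat \<Rightarrow> nat \<Rightarrow> 'a::comm_ring_1 tensor \<Rightarrow> nat \<Rightarrow> nat \<Rightarrow> nat \<Rightarrow> 'a tensor \<Rightarrow> bool" where
  "tensor_le m1 m2 m3 S n1 n2 n3 T \<longleftrightarrow>
     (\<exists>A \<in> carrier_mat m1 n1. \<exists>B \<in> carrier_mat m2 n2. \<exists>C \<in> carrier_mat m3 n3.
        tensor_eq m1 m2 m3 S (tensor_act n1 n2 n3 A B C T))"

definition unit_tensor :: "'a::comm_ring_1 tensor" where
  "unit_tensor = (\<lambda>i j k. if i = j \<and> j = k then 1 else 0)"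

text \<open>
  The set below contains 0 and, over a field, is bounded by each of \<open>n1\<close>, \<open>n2\<close>, \<open>n3\<close>, so the
  maximum exists.
\<close>

definition subrank :: "nat \<Rightarrow> nat \<Rightarrow> nat \<Rightarrow> 'a::comm_ring_1 tensor \<Rightarrow> nat" where
  "subrank n1 n2 n3 T = Max {s. tensor_le s s s unit_tensor n1 n2 n3 T}"

definition slice_tensor :: "nat \<Rightarrow> nat \<Rightarrow> nat \<Rightarrow> 'a::comm_ring_1 tensor \<Rightarrow> bool" where
  "slice_tensor n1 n2 n3 S \<longleftrightarrow>
     (\<exists>u \<in> carrier_vec n1. \<exists>V \<in> carrier_mat n2 n3.
        tensor_eq n1 n2 n3 S (\<lambda>i j k. u $ i * V $$ (j,k))) \<or>
     (\<exists>u \<in> carrier_vec n2. \<exists>V \<in> carrier_mat n1 n3.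
        tensor_eq n1 n2 n3 S (\<lambda>i j k. u $ j * V $$ (i,k))) \<or>
     (\<exists>u \<in> carrier_vec n3. \<exists>V \<in> carrier_mat n1 n2.
        tensor_eq n1 n2 n3 S (\<lambda>i j k. u $ k * V $$ (i,j)))"

definition slice_rank :: "nat \<Rightarrow> nat \<Rightarrow> nat \<Rightarrow> 'a::comm_ring_1 tensor \<Rightarrow> nat" where
  "slice_rank n1 n2 n3 T =
     (LEAST r. \<exists>S :: nat \<Rightarrow> 'a tensor. (\<forall>l<r. slice_tensor n1 n2 n3 (S l)) \<and>
        tensor_eq n1 n2 n3 T (\<lambda>i j k. \<Sum>l<r. S l i j k))"

end

theory Submission
  imports Defs "HOL-Library.Multiset" "HOL-Library.FuncSet"
begin

text \<open>
  Write \<open>X\<close> for the variety of pairs \<open>(x,y)\<close> with \<open>T(x,y,\<cdot>) = 0\<close> and \<open>N = n1 + n2\<close>.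

  If \<open>I_s = (A,B,C) \<cdot> T\<close>, the rows of \<open>A\<close> and of \<open>B\<close> are independent. Completing them to bases gives
  coordinates \<open>a_i, b_i\<close> along the rows and \<open>N - 2s\<close> further coordinates \<open>h\<close>, and on \<open>X\<close> each product
  \<open>a_i b_i\<close> lies in the ideal of the \<open>h\<close>. Hence polynomial functions of degree at most \<open>d\<close> on \<open>X\<close> are
  spanned by the monomials divisible by no \<open>a_i b_i\<close>, of which there are at most \<open>2^s (d+1)^(N-s)\<close>.
  A chain of irreducible subvarieties of length \<open>D\<close> provides \<open>D\<close> algebraically independent functions
  on \<open>X\<close> (one vanishing on each member but not on the next), so \<open>D \<le> N - s\<close> by comparing growth rates.

  If \<open>T\<close> is a sum of \<open>r\<close> slices, then \<open>X\<close> contains the zeros of \<open>r\<close> forms which are linear in \<open>x\<close> for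
  fixed \<open>y\<close>, or depend linearly on \<open>y\<close> alone. Fraction-free elimination parametrizes a piece of this
  zero set polynomially by at least \<open>N - r\<close> free coordinates, and the Zariski closures of the images of
  a flag of coordinate subspaces form a chain of length at least \<open>N - r\<close>.
\<close>

section \<open>Fraction-free linear algebra\<close>

lemma sum_pairing_step:
  fixes M :: "'c \<Rightarrow> 'a::comm_ring_1"
  shows "(\<Sum>c\<in>C. M c * (\<alpha> * x c - \<beta> * y c)) = \<alpha> * (\<Sum>c\<in>C. M c * x c) - \<beta> * (\<Sum>c\<in>C. M c * y c)"
  by (simp add: sum_subtractf sum_distrib_left algebra_simps)

lemma sum_fun_closed:
  assumes "(\<lambda>v. 0) \<in> R" "\<And>f g. f \<in> R \<Longrightarrow> g \<in> R \<Longrightarrow> (\<lambda>v. f v + g v) \<in> R"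
    "finite C" "\<And>c. c \<in> C \<Longrightarrow> f c \<in> R"
  shows "(\<lambda>v. \<Sum>c\<in>C. f c v) \<in> R"
  using assms(3,4) by (induction C rule: finite_induct) (auto intro: assms(1,2))

text \<open>
  Elimination over a ring \<open>R\<close> of functions that is an integral domain when restricted to \<open>D\<close>:
  instead of dividing by a pivot, the old solutions are cross-multiplied.
\<close>

lemma kernel_family:
  fixes M :: "'q \<Rightarrow> 'c \<Rightarrow> 'v \<Rightarrow> 'a::comm_ring_1"
  assumes "finite Q" and C: "finite C"
    and R0: "(\<lambda>v. 0) \<in> R" and R1: "(\<lambda>v. 1) \<in> R"
    and Radd: "\<And>f g. f \<in> R \<Longrightarrow> g \<in> R \<Longrightarrow> (\<lambda>v. f v + g v) \<in> R"
    and Rdiff: "\<And>f g. f \<in> R \<Longrightarrow> g \<in> R \<Longrightarrow> (\<lambda>v. f v - g v) \<in> R"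
    and Rmult: "\<And>f g. f \<in> R \<Longrightarrow> g \<in> R \<Longrightarrow> (\<lambda>v. f v * g v) \<in> R"
    and dom: "\<And>f g. f \<in> R \<Longrightarrow> g \<in> R \<Longrightarrow> \<exists>v\<in>D. f v \<noteq> 0 \<Longrightarrow> \<exists>v\<in>D. g v \<noteq> 0 \<Longrightarrow>
      \<exists>v\<in>D. f v * g v \<noteq> 0"
    and D: "D \<noteq> {}"
    and M: "\<And>q c. q \<in> Q \<Longrightarrow> c \<in> C \<Longrightarrow> M q c \<in> R"
  shows "\<exists>J\<subseteq>C. \<exists>\<delta>\<in>R. \<exists>w. card C \<le> card J + card Q \<and> (\<exists>v\<in>D. \<delta> v \<noteq> 0) \<and>
    (\<forall>j\<in>J. \<forall>c\<in>C. w j c \<in> R) \<and>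
    (\<forall>j\<in>J. \<forall>j'\<in>J. \<forall>v. w j j' v = (if j = j' then \<delta> v else 0)) \<and>
    (\<forall>q\<in>Q. \<forall>j\<in>J. \<forall>v\<in>D. (\<Sum>c\<in>C. M q c v * w j c v) = 0)"
  using assms(1) M
proof (induction Q rule: finite_induct)
  case empty
  show ?case
    by (rule exI[of _ C], intro conjI subset_refl bexI[of _ "\<lambda>v. 1"]
        exI[of _ "\<lambda>j c. if j = c then (\<lambda>v. 1) else (\<lambda>v. 0)"])
      (use D R0 R1 in auto)
next
  case (insert q0 Q)
  from insert.IH insert.prems obtain J \<delta> w where J: "J \<subseteq> C" and \<delta>: "\<delta> \<in> R" "\<exists>v\<in>D. \<delta> v \<noteq> 0"
    and card: "card C \<le> card J + card Q"
    and wR: "\<And>j c. j \<in> J \<Longrightarrow> c \<in> C \<Longrightarrow> w j c \<in> R"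
    and wJ: "\<And>j j' v. j \<in> J \<Longrightarrow> j' \<in> J \<Longrightarrow> w j j' v = (if j = j' then \<delta> v else 0)"
    and wQ: "\<And>q j v. q \<in> Q \<Longrightarrow> j \<in> J \<Longrightarrow> v \<in> D \<Longrightarrow> (\<Sum>c\<in>C. M q c v * w j c v) = 0"
    by (smt (verit) insertI2)
  have finJ: "finite J" using J C finite_subset by blast
  \<comment> \<open>\<open>e j\<close> is the defect of the \<open>j\<close>-th old solution in the
    new equation \<open>q0\<close>. If all defects vanish on \<open>D\<close>, the family is kept;
    otherwise one free index is spent as a pivot.\<close>
  define e where "e j = (\<lambda>v. \<Sum>c\<in>C. M q0 c v * w j c v)" for j
  have eR: "e j \<in> R" if "j \<in> J" for j
    unfolding e_def using that wR insert.prems by (intro sum_fun_closed R0 Radd C Rmult) auto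
  show ?case
  proof (cases "\<forall>j\<in>J. \<forall>v\<in>D. e j v = 0")
    case True
    have "card C \<le> card J + card (insert q0 Q)" using card insert.hyps by simp
    then show ?thesis
      by (intro exI[of _ J] conjI bexI[of _ \<delta>] exI[of _ w])
        (use J \<delta> wR wJ wQ True in \<open>auto simp: e_def\<close>)
  next
    case False
    then obtain j0 where j0: "j0 \<in> J" "\<exists>v\<in>D. e j0 v \<noteq> 0" by blast
    \<comment> \<open>Cross-multiplying by the defects cancels equation \<open>q0\<close>. The free
      block stays diagonal because \<open>w j0\<close> is 0 at the remaining free indices; its new
      entry \<open>e j0 * \<delta>\<close> is nonzero somewhere on \<open>D\<close> by
      \<open>dom\<close>.\<close>
    define w' where "w' j c = (\<lambda>v. e j0 v * w j c v - e j v * w j0 c v)" for j c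
    have "card C \<le> card (J - {j0}) + card (insert q0 Q)"
      using card insert.hyps j0 finJ by (simp add: card_Diff_singleton)
    moreover have "(\<lambda>v. e j0 v * \<delta> v) \<in> R" "\<exists>v\<in>D. e j0 v * \<delta> v \<noteq> 0"
      using eR[OF j0(1)] \<delta> j0 by (auto intro: Rmult dom)
    moreover have "w' j c \<in> R" if "j \<in> J" "c \<in> C" for j c
      unfolding w'_def using that j0 eR wR by (intro Rdiff Rmult) auto
    moreover have "w' j j' v = (if j = j' then e j0 v * \<delta> v else 0)"
      if "j \<in> J - {j0}" "j' \<in> J - {j0}" for j j' v
      using that wJ j0 by (auto simp: w'_def)
    moreover have "(\<Sum>c\<in>C. M q c v * w' j c v) = 0" if "q \<in> insert q0 Q" "j \<in> J" "v \<in> D" for q j v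
    proof -
      have *: "(\<Sum>c\<in>C. M q c v * w' j c v) =
          e j0 v * (\<Sum>c\<in>C. M q c v * w j c v) - e j v * (\<Sum>c\<in>C. M q c v * w j0 c v)"
        unfolding w'_def by (rule sum_pairing_step)
      show ?thesis
      proof (cases "q = q0")
        case True
        then show ?thesis using * by (simp add: e_def)
      next
        case False
        then show ?thesis using * wQ that j0 by simp
      qed
    qed
    ultimately show ?thesis using J
      by (intro exI[of _ "J - {j0}"] conjI bexI[of _ "\<lambda>v. e j0 v * \<delta> v"] exI[of _ w'])
         (simp_all, blast+)
  qed
qed

text \<open>Scalars are functions on the one-point type \<open>unit\<close>, so elimination over
  function rings specializes to constants.\<close>

lemma kernel_vectors:
  fixes M :: "'q \<Rightarrow> 'c \<Rightarrow> 'a::idom"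
  assumes "finite Q" "finite C"
  shows "\<exists>J\<subseteq>C. \<exists>\<delta> w. card C \<le> card J + card Q \<and> \<delta> \<noteq> 0 \<and>
    (\<forall>j\<in>J. \<forall>j'\<in>J. w j j' = (if j = j' then \<delta> else 0)) \<and>
    (\<forall>q\<in>Q. \<forall>j\<in>J. (\<Sum>c\<in>C. M q c * w j c) = 0)"
proof -
  have "\<exists>J\<subseteq>C. \<exists>\<delta>\<in>UNIV. \<exists>w. card C \<le> card J + card Q \<and> (\<exists>v\<in>UNIV. \<delta> v \<noteq> 0) \<and>
    (\<forall>j\<in>J. \<forall>c\<in>C. w j c \<in> UNIV) \<and>
    (\<forall>j\<in>J. \<forall>j'\<in>J. \<forall>v. w j j' v = (if j = j' then \<delta> v else 0)) \<and>
    (\<forall>q\<in>Q. \<forall>j\<in>J. \<forall>v::unit\<in>UNIV. (\<Sum>c\<in>C. M q c * w j c v) = 0)"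
    by (rule kernel_family[where M = "\<lambda>q c v. M q c"]) (use assms in auto)
  then obtain J \<delta> w u where "J \<subseteq> C" "card C \<le> card J + card Q" "\<delta> (u::unit) \<noteq> 0"
    "\<forall>j\<in>J. \<forall>j'\<in>J. \<forall>v. w j j' v = (if j = j' then \<delta> v else 0)"
    "\<forall>q\<in>Q. \<forall>j\<in>J. \<forall>v\<in>UNIV. (\<Sum>c\<in>C. M q c * w j c v) = 0"
    by (elim exE bexE conjE) (rule that)
  then show ?thesis
    by (intro exI[of _ J] conjI exI[of _ "\<delta> u"] exI[of _ "\<lambda>j c. w j c u"]) blast+
qed

text \<open>With fewer equations than unknowns a free index \<open>j\<close> remains, and its
  solution is nonzero because its own entry is \<open>\<delta>\<close>.\<close>

lemma nontrivial_relation: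
  fixes M :: "'q \<Rightarrow> 'c \<Rightarrow> 'a::idom"
  assumes "finite Q" "finite C" "card Q < card C"
  shows "\<exists>u. (\<exists>c\<in>C. u c \<noteq> 0) \<and> (\<forall>q\<in>Q. (\<Sum>c\<in>C. M q c * u c) = 0)"
proof -
  obtain J \<delta> w where J: "J \<subseteq> C" "card C \<le> card J + card Q" "\<delta> \<noteq> 0"
    "\<forall>j\<in>J. \<forall>j'\<in>J. w j j' = (if j = j' then \<delta> else 0)"
    "\<forall>q\<in>Q. \<forall>j\<in>J. (\<Sum>c\<in>C. M q c * w j c) = 0"
    using kernel_vectors[OF assms(1,2), of M] by blast
  from J(2) assms obtain j where "j \<in> J" by fastforce
  then have "w j j \<noteq> 0" "j \<in> C" using J by auto
  with \<open>j \<in> J\<close> show ?thesis using J(5) by blast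
qed

text \<open>Steinitz exchange: starting from all unit vectors, each independent row
  \<open>r i\<close> takes the place of one of them, and the family keeps spanning.\<close>

lemma steinitz_coordinates:
  fixes r :: "'i \<Rightarrow> 'c \<Rightarrow> 'a::field"
  assumes "finite I" and C: "finite C"
    and "\<And>u. (\<And>c. c \<in> C \<Longrightarrow> (\<Sum>i\<in>I. u i * r i c) = 0) \<Longrightarrow> \<forall>i\<in>I. u i = 0"
  shows "\<exists>J\<subseteq>C. card J + card I = card C \<and>
    (\<forall>x. \<exists>a b. \<forall>c\<in>C. x c = (\<Sum>i\<in>I. a i * r i c) + (if c \<in> J then b c else 0))"
  using assms(1,3)
proof (induction I rule: finite_induct)
  case empty
  show ?case by (intro exI[of _ C]) auto
next
  case (insert i0 I)
  have "\<forall>i\<in>I. u i = 0" if "\<And>c. c \<in> C \<Longrightarrow> (\<Sum>i\<in>I. u i * r i c) = 0" for u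
  proof -
    have "(\<Sum>i\<in>I. (if i = i0 then 0 else u i) * r i c) = (\<Sum>i\<in>I. u i * r i c)" for c
      by (rule sum.cong) (use insert.hyps in auto)
    then have "\<forall>i\<in>insert i0 I. (if i = i0 then 0 else u i) = 0"
      using that insert.hyps by (intro insert.prems) auto
    then show ?thesis using insert.hyps by (metis insertI2)
  qed
  from insert.IH[OF this] obtain J where J: "J \<subseteq> C" and card: "card J + card I = card C"
    and ex: "\<And>x. \<exists>a b. \<forall>c\<in>C. x c = (\<Sum>i\<in>I. a i * r i c) + (if c \<in> J then b c else 0)"
    by blast
  have finJ: "finite J" using J C finite_subset by blast
  obtain \<alpha> \<beta> where r0: "\<And>c. c \<in> C \<Longrightarrow> r i0 c = (\<Sum>i\<in>I. \<alpha> i * r i c) + (if c \<in> J then \<beta> c else 0)"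
    using ex[of "r i0"] by blast
  \<comment> \<open>If \<open>r i0\<close> involved no remaining unit vector, it would be a
    combination of the other rows; coefficient -1 at \<open>i0\<close> then gives a nontrivial
    relation.\<close>
  have "\<exists>j0\<in>J. \<beta> j0 \<noteq> 0"
  proof (rule ccontr)
    assume "\<not> ?thesis"
    then have *: "r i0 c = (\<Sum>i\<in>I. \<alpha> i * r i c)" if "c \<in> C" for c
      using r0[OF that] by auto
    have "(\<Sum>i\<in>insert i0 I. (if i = i0 then -1 else \<alpha> i) * r i c) = 0" if "c \<in> C" for c
    proof -
      have "(\<Sum>i\<in>I. (if i = i0 then -1 else \<alpha> i) * r i c) = (\<Sum>i\<in>I. \<alpha> i * r i c)"
        by (rule sum.cong) (use insert.hyps in auto)
      then show ?thesis using insert.hyps *[OF that] by simp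
    qed
    from insert.prems[OF this] show False by auto
  qed
  then obtain j0 where j0: "j0 \<in> J" and nz: "\<beta> j0 \<noteq> 0" by blast
  have "card (J - {j0}) + card (insert i0 I) = card C"
    using card insert.hyps j0 finJ by (simp add: card_Diff_singleton)
      (metis Suc_pred add_Suc add_Suc_right card_gt_0_iff empty_iff)
  moreover have "\<exists>a b. \<forall>c\<in>C. x c = (\<Sum>i\<in>insert i0 I. a i * r i c) + (if c \<in> J - {j0} then b c else 0)"
    for x
  proof -
    obtain a b where x: "\<And>c. c \<in> C \<Longrightarrow> x c = (\<Sum>i\<in>I. a i * r i c) + (if c \<in> J then b c else 0)"
      using ex[of x] by blast
    \<comment> \<open>\<open>t\<close> copies of \<open>r i0\<close> absorb the share of the unit
      vector at \<open>j0\<close>; the other coefficients are corrected for what \<open>r i0\<close>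
      contributes elsewhere.\<close>
    define t where "t = b j0 / \<beta> j0"
    define a' where "a' i = (if i = i0 then t else a i - t * \<alpha> i)" for i
    have "x c = (\<Sum>i\<in>insert i0 I. a' i * r i c) + (if c \<in> J - {j0} then b c - t * \<beta> c else 0)"
      if c: "c \<in> C" for c
    proof -
      have "(\<Sum>i\<in>I. a' i * r i c) = (\<Sum>i\<in>I. a i * r i c - t * (\<alpha> i * r i c))"
        by (rule sum.cong) (use insert.hyps in \<open>auto simp: a'_def algebra_simps\<close>)
      also have "\<dots> = (\<Sum>i\<in>I. a i * r i c) - t * (\<Sum>i\<in>I. \<alpha> i * r i c)"
        by (simp add: sum_subtractf sum_distrib_left)
      also have "\<dots> = x c - (if c \<in> J then b c else 0) - t * (r i0 c - (if c \<in> J then \<beta> c else 0))"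
        using x[OF c] r0[OF c] by (simp add: algebra_simps)
      finally show ?thesis using insert.hyps nz j0
        by (auto simp: a'_def t_def algebra_simps)
    qed
    then show ?thesis by (intro exI[of _ a'] exI[of _ "\<lambda>c. b c - t * \<beta> c"]) blast
  qed
  ultimately show ?case using J by (intro exI[of _ "J - {j0}"]) auto
qed

section \<open>Linear combinations on a set\<close>

text \<open>Equality is demanded only on \<open>X\<close>: this is membership in a linear span
  modulo the functions vanishing on \<open>X\<close>.\<close>

definition comb_on :: "'v set \<Rightarrow> ('m \<Rightarrow> 'v \<Rightarrow> 'a::comm_ring_1) \<Rightarrow> 'm set \<Rightarrow> ('v \<Rightarrow> 'a) \<Rightarrow> bool" where
  "comb_on X m B f \<longleftrightarrow> (\<exists>c. \<forall>v\<in>X. f v = (\<Sum>b\<in>B. c b * m b v))"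

lemma comb_on_cong: "(\<And>v. v \<in> X \<Longrightarrow> f v = g v) \<Longrightarrow> comb_on X m B f \<longleftrightarrow> comb_on X m B g"
  unfolding comb_on_def by auto

lemma comb_on_zero: "comb_on X m B (\<lambda>v. 0)"
  unfolding comb_on_def by (rule exI[of _ "\<lambda>_. 0"]) simp

lemma comb_on_add:
  assumes "comb_on X m B f" "comb_on X m B g" shows "comb_on X m B (\<lambda>v. f v + g v)"
proof -
  obtain c d where "\<forall>v\<in>X. f v = (\<Sum>b\<in>B. c b * m b v)" "\<forall>v\<in>X. g v = (\<Sum>b\<in>B. d b * m b v)"
    using assms unfolding comb_on_def by auto
  then show ?thesis unfolding comb_on_def
    by (intro exI[of _ "\<lambda>b. c b + d b"]) (simp add: sum.distrib distrib_right)
qed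

lemma comb_on_scale:
  assumes "comb_on X m B f" shows "comb_on X m B (\<lambda>v. k * f v)"
proof -
  obtain c where "\<forall>v\<in>X. f v = (\<Sum>b\<in>B. c b * m b v)"
    using assms unfolding comb_on_def by auto
  then show ?thesis unfolding comb_on_def
    by (intro exI[of _ "\<lambda>b. k * c b"]) (simp add: sum_distrib_left mult.assoc)
qed

lemma comb_on_sum:
  assumes "\<And>i. i \<in> I \<Longrightarrow> comb_on X m B (f i)"
  shows "comb_on X m B (\<lambda>v. \<Sum>i\<in>I. f i v)"
  using assms by (induction I rule: infinite_finite_induct) (auto intro: comb_on_add comb_on_zero)

lemma comb_on_base: "finite B \<Longrightarrow> b \<in> B \<Longrightarrow> comb_on X m B (m b)"
  unfolding comb_on_def
  by (rule exI[of _ "\<lambda>b'. if b' = b then 1 else 0"]) (simp add: if_distrib[of "\<lambda>k. k * _"] cong: if_cong)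

lemma comb_on_trans:
  assumes "comb_on X m B f" "\<And>b. b \<in> B \<Longrightarrow> comb_on X m' B' (m b)"
  shows "comb_on X m' B' f"
proof -
  obtain c where c: "\<And>v. v \<in> X \<Longrightarrow> f v = (\<Sum>b\<in>B. c b * m b v)"
    using assms(1) unfolding comb_on_def by auto
  have "comb_on X m' B' (\<lambda>v. \<Sum>b\<in>B. c b * m b v)"
    by (intro comb_on_sum comb_on_scale assms(2))
  then show ?thesis by (subst comb_on_cong[OF c])
qed

lemma comb_on_mult:
  assumes "comb_on X m B f" "comb_on X m' B' g"
    "\<And>b b'. b \<in> B \<Longrightarrow> b' \<in> B' \<Longrightarrow> comb_on X m'' B'' (\<lambda>v. m b v * m' b' v)"
  shows "comb_on X m'' B'' (\<lambda>v. f v * g v)"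
proof -
  obtain c where c: "\<And>v. v \<in> X \<Longrightarrow> f v = (\<Sum>b\<in>B. c b * m b v)"
    using assms(1) unfolding comb_on_def by auto
  obtain d where d: "\<And>v. v \<in> X \<Longrightarrow> g v = (\<Sum>b\<in>B'. d b * m' b v)"
    using assms(2) unfolding comb_on_def by auto
  have eq: "f v * g v = (\<Sum>b\<in>B. \<Sum>b'\<in>B'. (c b * d b') * (m b v * m' b' v))" if "v \<in> X" for v
    by (simp add: c[OF that] d[OF that] sum_product mult_ac)
  have "comb_on X m'' B'' (\<lambda>v. \<Sum>b\<in>B. \<Sum>b'\<in>B'. (c b * d b') * (m b v * m' b' v))"
    by (intro comb_on_sum comb_on_scale assms(3))
  then show ?thesis by (subst comb_on_cong[OF eq])
qed

text \<open>If there were more functions \<open>u a\<close> than spanning functions, their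
  coefficient vectors would satisfy a nontrivial relation, which the functions would inherit on
  \<open>X\<close>.\<close>

lemma comb_on_card_le:
  fixes m :: "'m \<Rightarrow> 'v \<Rightarrow> 'a::idom"
  assumes "finite A" "finite B" "\<And>a. a \<in> A \<Longrightarrow> comb_on X m B (u a)"
    and indep: "\<And>c. (\<And>v. v \<in> X \<Longrightarrow> (\<Sum>a\<in>A. c a * u a v) = 0) \<Longrightarrow> \<forall>a\<in>A. c a = 0"
  shows "card A \<le> card B"
proof (rule ccontr)
  assume "\<not> card A \<le> card B"
  then have less: "card B < card A" by simp
  have "\<exists>k. \<forall>v\<in>X. u a v = (\<Sum>b\<in>B. k b * m b v)" if "a \<in> A" for a
    using assms(3)[OF that] unfolding comb_on_def .
  then obtain k where k: "\<And>a v. a \<in> A \<Longrightarrow> v \<in> X \<Longrightarrow> u a v = (\<Sum>b\<in>B. k a b * m b v)"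
    by metis
  obtain c where c: "\<exists>a\<in>A. c a \<noteq> 0" "\<And>b. b \<in> B \<Longrightarrow> (\<Sum>a\<in>A. k a b * c a) = 0"
    using nontrivial_relation[OF assms(2,1) less, of "\<lambda>b a. k a b"] by auto
  have "(\<Sum>a\<in>A. c a * u a v) = 0" if "v \<in> X" for v
  proof -
    have "(\<Sum>a\<in>A. c a * u a v) = (\<Sum>a\<in>A. \<Sum>b\<in>B. m b v * (k a b * c a))"
      by (rule sum.cong) (auto simp: k that sum_distrib_left mult_ac)
    also have "\<dots> = (\<Sum>b\<in>B. m b v * (\<Sum>a\<in>A. k a b * c a))"
      by (subst sum.swap) (simp add: sum_distrib_left)
    finally show ?thesis using c(2) by simp
  qed
  from indep[OF this] c(1) show False by auto
qed

section \<open>Monomials modulo quadratic relations\<close>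

text \<open>Multisets serve as exponent vectors, so that multiplying monomials means adding
  multisets.\<close>

definition gen_monomial :: "('g \<Rightarrow> 'v \<Rightarrow> 'a::comm_ring_1) \<Rightarrow> 'g multiset \<Rightarrow> 'v \<Rightarrow> 'a" where
  "gen_monomial val M v = (\<Prod>g\<in>#M. val g v)"

lemma gen_monomial_simps [simp]:
  "gen_monomial val {#} v = 1"
  "gen_monomial val (add_mset g M) v = val g v * gen_monomial val M v"
  "gen_monomial val (M + M') v = gen_monomial val M v * gen_monomial val M' v"
  unfolding gen_monomial_def by auto

definition multisets_upto :: "'g set \<Rightarrow> nat \<Rightarrow> 'g multiset set" where
  "multisets_upto G d = {M. set_mset M \<subseteq> G \<and> size M \<le> d}"

lemma finite_multisets_upto:
  assumes "finite G" shows "finite (multisets_upto G d)"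
proof (rule finite_subset)
  show "multisets_upto G d \<subseteq> mset ` {xs. set xs \<subseteq> G \<and> length xs \<le> d}"
  proof
    fix M assume "M \<in> multisets_upto G d"
    moreover obtain xs where "M = mset xs" using ex_mset by metis
    ultimately show "M \<in> mset ` {xs. set xs \<subseteq> G \<and> length xs \<le> d}"
      by (auto simp: multisets_upto_def)
  qed
  show "finite (mset ` {xs. set xs \<subseteq> G \<and> length xs \<le> d})"
    using assms by (intro finite_imageI finite_lists_length_le)
qed

definition reduced_multisets ::
  "'g set \<Rightarrow> (nat \<Rightarrow> 'g) \<Rightarrow> (nat \<Rightarrow> 'g) \<Rightarrow> nat \<Rightarrow> nat \<Rightarrow> 'g multiset set" where
  "reduced_multisets G a b s d = {M \<in> multisets_upto G d. \<forall>i<s. a i \<notin># M \<or> b i \<notin># M}"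

text \<open>Each rewriting step lowers the number of factors outside \<open>H\<close>.\<close>

lemma reduce_monomial:
  assumes G: "finite G" and H: "H \<subseteq> G"
    and ab: "\<And>i. i < s \<Longrightarrow> a i \<in> G - H \<and> b i \<in> G - H \<and> a i \<noteq> b i"
    and rel: "\<And>i. i < s \<Longrightarrow> comb_on X (\<lambda>(h,g) v. val h v * val g v) (H \<times> G) (\<lambda>v. val (a i) v * val (b i) v)"
  shows "M \<in> multisets_upto G d \<Longrightarrow>
    comb_on X (gen_monomial val) (reduced_multisets G a b s d) (gen_monomial val M)"
proof (induction "size (filter_mset (\<lambda>g. g \<notin> H) M)" arbitrary: M rule: less_induct)
  case less
  show ?case
  proof (cases "M \<in> reduced_multisets G a b s d")
    case True
    then show ?thesis
      using finite_multisets_upto[OF G, of d] by (intro comb_on_base) (auto simp: reduced_multisets_def)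
  next
    case False
    then obtain i where i: "i < s" "a i \<in># M" "b i \<in># M"
      using less.prems by (auto simp: reduced_multisets_def)
    obtain N where N: "M = add_mset (a i) N" using i(2) by (metis multi_member_split)
    with i(1,3) ab[of i] have "b i \<in># N" by auto
    with N obtain M' where M': "M = add_mset (a i) (add_mset (b i) M')"
      by (metis multi_member_split)
    have "comb_on X (gen_monomial val) (reduced_multisets G a b s d)
      (\<lambda>v. (val (a i) v * val (b i) v) * gen_monomial val M' v)"
    proof (rule comb_on_mult[OF rel[OF i(1)] comb_on_base[of "{M'}" M']])
      fix hg N assume hg: "hg \<in> H \<times> G" and "N \<in> {M'}"
      then obtain h g where hg': "hg = (h, g)" "h \<in> H" "g \<in> G" and N: "N = M'" by auto
      \<comment> \<open>Both \<open>a i\<close> and \<open>b i\<close> lie outside \<open>H\<close>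
        but \<open>h\<close> lies in it, so replacing the pair by \<open>h\<close> and
        \<open>g\<close> keeps the size and lowers the measure even when \<open>g\<close> is outside
        \<open>H\<close>.\<close>
      have "comb_on X (gen_monomial val) (reduced_multisets G a b s d)
        (gen_monomial val (add_mset h (add_mset g M')))"
        using less.prems hg' ab[OF i(1)] H
        by (intro less.hyps) (auto simp: M' multisets_upto_def)
      then show "comb_on X (gen_monomial val) (reduced_multisets G a b s d)
          (\<lambda>v. (case hg of (h, g) \<Rightarrow> \<lambda>v. val h v * val g v) v * gen_monomial val N v)"
        by (simp add: hg' N mult.assoc cong: comb_on_cong)
    qed auto
    then show ?thesis by (simp add: M' mult.assoc cong: comb_on_cong)
  qed
qed

text \<open>For each \<open>i\<close> one of \<open>a i\<close>, \<open>b i\<close> is absent. There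
  are \<open>2 ^ s\<close> ways to choose the absentees, and each choice leaves
  \<open>card G - s\<close> generators with exponents from 0 to \<open>d\<close>.\<close>

lemma card_reduced_multisets:
  assumes G: "finite G" and ab: "\<And>i. i < s \<Longrightarrow> a i \<in> G \<and> b i \<in> G"
    and inj: "inj_on a {..<s}" "inj_on b {..<s}" and disj: "a ` {..<s} \<inter> b ` {..<s} = {}"
  shows "card (reduced_multisets G a b s d) \<le> 2 ^ s * (d + 1) ^ (card G - s)"
proof -
  \<comment> \<open>\<open>S\<close> records the pairs in which \<open>a i\<close> is the absent
    generator; in the other pairs it is \<open>b i\<close>. \<open>E S\<close> is the set of
    exponent functions compatible with this choice.\<close>
  define Z where "Z S = a ` S \<union> b ` ({..<s} - S)" for S
  define E where "E S = PiE G (\<lambda>g. if g \<in> Z S then {0} else {..d})" for S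
  have ZG: "Z S \<subseteq> G" if "S \<subseteq> {..<s}" for S using that ab by (auto simp: Z_def)
  have cZ: "card (Z S) = s" if S: "S \<subseteq> {..<s}" for S
  proof -
    have fS: "finite S" using S finite_subset by blast
    have "card (Z S) = card (a ` S) + card (b ` ({..<s} - S))"
      unfolding Z_def using disj S fS by (intro card_Un_disjoint) auto
    also have "\<dots> = card S + card ({..<s} - S)"
      using inj S by (simp add: card_image inj_on_subset[of a "{..<s}"] inj_on_subset[of b "{..<s}"])
    also have "\<dots> = s" using S fS card_mono[OF _ S] by (simp add: card_Diff_subset)
    finally show ?thesis .
  qed
  have cE: "card (E S) = (d + 1) ^ (card G - s)" if S: "S \<subseteq> {..<s}" for S
  proof -
    have "card (E S) = (\<Prod>g\<in>G. if g \<in> Z S then 1 else d + 1)"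
      unfolding E_def using G by (subst card_PiE) (auto intro!: prod.cong)
    also have "\<dots> = (d + 1) ^ card (G - Z S)"
      using G by (simp add: prod.If_cases Diff_eq)
    also have "card (G - Z S) = card G - s"
      using card_Diff_subset[OF finite_subset[OF ZG[OF S] G] ZG[OF S]] cZ[OF S] by simp
    finally show ?thesis .
  qed
  have finE: "finite (E S)" for S unfolding E_def using G by (intro finite_PiE) auto
  let ?U = "\<Union>S\<in>Pow {..<s}. E S"
  have "(\<lambda>M. restrict (count M) G) ` reduced_multisets G a b s d \<subseteq> ?U"
  proof (rule image_subsetI)
    fix M assume M: "M \<in> reduced_multisets G a b s d"
    define S where "S = {i. i < s \<and> a i \<notin># M}"
    have "count M g \<le> d" for g
      using M count_le_size[of M g] by (auto simp: reduced_multisets_def multisets_upto_def)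
    moreover have "count M g = 0" if "g \<in> Z S" for g
      using that M by (auto simp: Z_def S_def reduced_multisets_def not_in_iff)
    ultimately have "restrict (count M) G \<in> E S" by (auto simp: E_def)
    then show "restrict (count M) G \<in> ?U" by (auto simp: S_def)
  qed
  moreover have "inj_on (\<lambda>M. restrict (count M) G) (reduced_multisets G a b s d)"
  proof (rule inj_onI)
    fix M N assume MN: "M \<in> reduced_multisets G a b s d" "N \<in> reduced_multisets G a b s d"
      and eq: "restrict (count M) G = restrict (count N) G"
    show "M = N"
    proof (rule multiset_eqI)
      fix g
      show "count M g = count N g"
      proof (cases "g \<in> G")
        case True
        then show ?thesis using fun_cong[OF eq, of g] by simp
      next
        case False
        then have "g \<notin># M" "g \<notin># N" using MN by (auto simp: reduced_multisets_def multisets_upto_def)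
        then show ?thesis by (simp add: not_in_iff)
      qed
    qed
  qed
  ultimately have "card (reduced_multisets G a b s d) \<le> card ?U"
    using finE by (intro card_inj_on_le) auto
  also have "\<dots> \<le> (\<Sum>S\<in>Pow {..<s}. card (E S))" by (intro card_UN_le) auto
  also have "\<dots> = 2 ^ s * (d + 1) ^ (card G - s)" using cE by (simp add: card_Pow)
  finally show ?thesis .
qed

section \<open>Chains of irreducible varieties\<close>

lemma comb_on_multisets_mono:
  assumes "finite G" "d \<le> e" "comb_on X (gen_monomial val) (multisets_upto G d) f"
  shows "comb_on X (gen_monomial val) (multisets_upto G e) f"
  using assms(3)
proof (rule comb_on_trans)
  fix M assume "M \<in> multisets_upto G d"
  then show "comb_on X (gen_monomial val) (multisets_upto G e) (gen_monomial val M)"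
    using assms(1,2) by (intro comb_on_base finite_multisets_upto) (auto simp: multisets_upto_def)
qed

lemma comb_on_multisets_one:
  assumes "finite G"
  shows "comb_on X (gen_monomial val) (multisets_upto G d) (\<lambda>v. 1)"
proof -
  have "comb_on X (gen_monomial val) (multisets_upto G d) (gen_monomial val {#})"
    using assms by (intro comb_on_base finite_multisets_upto) (auto simp: multisets_upto_def)
  then show ?thesis by (simp cong: comb_on_cong)
qed

lemma comb_on_multisets_mult:
  assumes G: "finite G"
    and "comb_on X (gen_monomial val) (multisets_upto G d) f"
    and "comb_on X (gen_monomial val) (multisets_upto G e) g"
  shows "comb_on X (gen_monomial val) (multisets_upto G (d + e)) (\<lambda>v. f v * g v)"
  using assms(2,3)
proof (rule comb_on_mult)
  fix M N assume MN: "M \<in> multisets_upto G d" "N \<in> multisets_upto G e"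
  then have "comb_on X (gen_monomial val) (multisets_upto G (d + e)) (gen_monomial val (M + N))"
    using G by (intro comb_on_base finite_multisets_upto) (auto simp: multisets_upto_def)
  then show "comb_on X (gen_monomial val) (multisets_upto G (d + e))
      (\<lambda>v. gen_monomial val M v * gen_monomial val N v)"
    by (simp cong: comb_on_cong)
qed

lemma comb_on_multisets_power:
  assumes G: "finite G" and f: "comb_on X (gen_monomial val) (multisets_upto G e) f"
  shows "comb_on X (gen_monomial val) (multisets_upto G (k * e)) (\<lambda>v. f v ^ k)"
proof (induction k)
  case 0
  show ?case using comb_on_multisets_one[OF G] by simp
next
  case (Suc k)
  show ?case using comb_on_multisets_mult[OF G f Suc] by simp
qed

text \<open>On \<open>X\<close> the coordinates are linear in the generators, so a degree bound
  propagates through the construction of \<open>p\<close>: the maximum for sums, the sum for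
  products.\<close>

lemma poly_fun_comb_on:
  assumes G: "finite G" and coord: "\<And>i. i < n \<Longrightarrow> comb_on X val G (\<lambda>v. v $ i)"
    and "p \<in> poly_funs n"
  shows "\<exists>e. comb_on X (gen_monomial val) (multisets_upto G e) p"
  using assms(3)
proof (induction rule: poly_funs.induct)
  case (const c)
  show ?case using comb_on_scale[OF comb_on_multisets_one[OF G], of X val 0 c] by auto
next
  case (coord i)
  have "comb_on X (gen_monomial val) (multisets_upto G 1) (\<lambda>v. v $ i)"
    using assms(2)[OF coord]
  proof (rule comb_on_trans)
    fix g assume "g \<in> G"
    then have "comb_on X (gen_monomial val) (multisets_upto G 1) (gen_monomial val {#g#})"
      using G by (intro comb_on_base finite_multisets_upto) (auto simp: multisets_upto_def)
    then show "comb_on X (gen_monomial val) (multisets_upto G 1) (val g)"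
      by (simp cong: comb_on_cong)
  qed
  then show ?case by blast
next
  case (add p q)
  then obtain d e where "comb_on X (gen_monomial val) (multisets_upto G d) p"
    "comb_on X (gen_monomial val) (multisets_upto G e) q" by blast
  then have "comb_on X (gen_monomial val) (multisets_upto G (max d e)) (\<lambda>v. p v + q v)"
    using comb_on_multisets_mono[OF G max.cobounded1] comb_on_multisets_mono[OF G max.cobounded2]
    by (intro comb_on_add)
  then show ?case by blast
next
  case (mult p q)
  then show ?case using comb_on_multisets_mult[OF G] by blast
qed

section \<open>Independent functions along a chain of irreducible varieties\<close>

lemma irreducible_variety_zero_set:
  "irreducible_variety n Z \<Longrightarrow> \<exists>P\<subseteq>poly_funs n. Z = {v \<in> carrier_vec n. \<forall>p\<in>P. p v = 0}"
  unfolding irreducible_variety_def affine_variety_def by blast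

text \<open>Adding \<open>p\<close> or \<open>q\<close> to the equations gives two closed subsets
  covering \<open>Z\<close>, and irreducibility makes one of them all of \<open>Z\<close>. This is
  primality of the vanishing ideal.\<close>

lemma irreducible_variety_prime:
  assumes irr: "irreducible_variety n Z" and pq: "p \<in> poly_funs n" "q \<in> poly_funs n"
    and z: "\<And>v. v \<in> Z \<Longrightarrow> p v * q v = (0::'a::idom)"
  shows "(\<forall>v\<in>Z. p v = 0) \<or> (\<forall>v\<in>Z. q v = 0)"
proof -
  obtain P where P: "P \<subseteq> poly_funs n" "Z = {v \<in> carrier_vec n. \<forall>p\<in>P. p v = 0}"
    using irreducible_variety_zero_set[OF irr] by blast
  have av: "affine_variety n {v\<in>Z. f v = 0}" if "f \<in> poly_funs n" for f
    unfolding affine_variety_def using P that by (intro exI[of _ "insert f P"]) auto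
  have "Z = {v\<in>Z. p v = 0} \<union> {v\<in>Z. q v = 0}" using z by auto
  then have "Z = {v\<in>Z. p v = 0} \<or> Z = {v\<in>Z. q v = 0}"
    using irr av pq unfolding irreducible_variety_def by blast
  then show ?thesis by blast
qed

text \<open>Exponents are listed from the top down: the head belongs to the function of highest
  index, so removing the largest member of a chain removes the head.\<close>

fun tower_monomial :: "(nat \<Rightarrow> 'v \<Rightarrow> 'a::comm_ring_1) \<Rightarrow> nat list \<Rightarrow> 'v \<Rightarrow> 'a" where
  "tower_monomial f [] v = 1"
| "tower_monomial f (k # ks) v = f (length ks) v ^ k * tower_monomial f ks v"

lemma poly_funs_sum:
  "(\<And>i. i \<in> I \<Longrightarrow> f i \<in> poly_funs n) \<Longrightarrow> (\<lambda>v. \<Sum>i\<in>I. f i v) \<in> poly_funs n"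
  by (induction I rule: infinite_finite_induct) (auto intro: poly_funs.intros)

lemma poly_funs_power: "f \<in> poly_funs n \<Longrightarrow> (\<lambda>v. f v ^ k) \<in> poly_funs n"
  by (induction k) (auto intro: poly_funs.intros)

lemma poly_funs_diff:
  assumes "f \<in> poly_funs n" "g \<in> poly_funs n" shows "(\<lambda>v. f v - g v) \<in> poly_funs n"
  using poly_funs.add[OF assms(1) poly_funs.mult[OF poly_funs.const[of "-1"] assms(2)]] by simp

lemma tower_monomial_poly_fun:
  "(\<And>i. i < length ks \<Longrightarrow> f i \<in> poly_funs n) \<Longrightarrow> tower_monomial f ks \<in> poly_funs n"
proof (induction ks)
  case (Cons k ks)
  then have "(\<lambda>v. f (length ks) v ^ k * tower_monomial f ks v) \<in> poly_funs n"
    by (intro poly_funs.mult poly_funs_power) auto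
  moreover have "tower_monomial f (k # ks) = (\<lambda>v. f (length ks) v ^ k * tower_monomial f ks v)"
    by (rule ext) simp
  ultimately show ?case by simp
next
  case Nil
  have "tower_monomial f [] = (\<lambda>v. 1)" by (rule ext) simp
  then show ?case by (simp add: poly_funs.const)
qed

text \<open>
  Evaluating on \<open>Z'\<close>, where \<open>f\<close> vanishes, isolates the constant coefficient; on \<open>Z\<close> the factor
  \<open>f\<close> can then be cancelled.
\<close>

lemma vanishing_power_series:
  fixes f :: "'a::idom vec \<Rightarrow> 'a"
  assumes irr: "irreducible_variety n Z" and sub: "Z' \<subseteq> Z"
    and f: "f \<in> poly_funs n" "\<And>v. v \<in> Z' \<Longrightarrow> f v = 0" "\<exists>v\<in>Z. f v \<noteq> 0"
    and g: "\<And>j. j < m \<Longrightarrow> g j \<in> poly_funs n"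
      "\<And>j. j < m \<Longrightarrow> (\<And>v. v \<in> Z' \<Longrightarrow> g j v = 0) \<Longrightarrow> (\<And>v. v \<in> Z \<Longrightarrow> g j v = 0)"
    and z: "\<And>v. v \<in> Z \<Longrightarrow> (\<Sum>j<m. f v ^ j * g j v) = 0"
  shows "j < m \<Longrightarrow> v \<in> Z' \<Longrightarrow> g j v = 0"
  using g z
proof (induction m arbitrary: g j v)
  case (Suc m)
  have split: "(\<Sum>j<Suc m. f v ^ j * g j v) = g 0 v + f v * (\<Sum>j<m. f v ^ j * g (Suc j) v)" for v
    unfolding sum.lessThan_Suc_shift by (simp add: sum_distrib_left mult.assoc)
  have g0': "g 0 v = 0" if "v \<in> Z'" for v
    using Suc.prems(5)[of v] split[of v] f(2)[OF that] that sub by auto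
  have g0: "g 0 v = 0" if "v \<in> Z" for v
    using Suc.prems(4)[of 0] g0' that by blast
  have "(\<forall>v\<in>Z. f v = 0) \<or> (\<forall>v\<in>Z. (\<Sum>j<m. f v ^ j * g (Suc j) v) = 0)"
  proof (rule irreducible_variety_prime[OF irr f(1)])
    show "(\<lambda>v. \<Sum>j<m. f v ^ j * g (Suc j) v) \<in> poly_funs n"
      using Suc.prems(3) f(1) by (intro poly_funs_sum poly_funs.mult poly_funs_power) auto
    show "f v * (\<Sum>j<m. f v ^ j * g (Suc j) v) = 0" if "v \<in> Z" for v
      using Suc.prems(5)[OF that] split[of v] g0[OF that] by simp
  qed
  then have zz: "\<And>v. v \<in> Z \<Longrightarrow> (\<Sum>j<m. f v ^ j * g (Suc j) v) = 0" using f(3) by blast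
  have gS: "g (Suc j') v = 0" if "j' < m" for j'
    by (rule Suc.IH[where g = "\<lambda>j. g (Suc j)"]) (use that Suc.prems(2-4) zz in blast)+
  show ?case using g0'[OF Suc.prems(2)] gS Suc.prems(1) by (cases j) auto
qed simp

text \<open>Induction on the chain length: sorted by powers of \<open>f D\<close>, a relation on
  \<open>Z (Suc D)\<close> has coefficients that vanish on \<open>Z D\<close>, and the induction
  hypothesis applies to each of them.\<close>

lemma tower_monomials_independent:
  fixes f :: "nat \<Rightarrow> 'a::idom vec \<Rightarrow> 'a"
  assumes irr: "\<And>i. i \<le> D \<Longrightarrow> irreducible_variety n (Z i)"
    and sub: "\<And>i. i < D \<Longrightarrow> Z i \<subseteq> Z (Suc i)"
    and f: "\<And>i. i < D \<Longrightarrow> f i \<in> poly_funs n" "\<And>i v. i < D \<Longrightarrow> v \<in> Z i \<Longrightarrow> f i v = 0"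
      "\<And>i. i < D \<Longrightarrow> \<exists>v\<in>Z (Suc i). f i v \<noteq> 0"
    and z: "\<And>v. v \<in> Z D \<Longrightarrow>
      (\<Sum>ks | set ks \<subseteq> {..<m} \<and> length ks = D. c ks * tower_monomial f ks v) = 0"
  shows "set ks \<subseteq> {..<m} \<Longrightarrow> length ks = D \<Longrightarrow> c ks = 0"
  using assms
proof (induction D arbitrary: c ks)
  case 0
  have "{ks. set ks \<subseteq> {..<m} \<and> length ks = 0} = {[]}" by auto
  moreover obtain v where "v \<in> Z 0" using 0(3)[of 0] unfolding irreducible_variety_def by blast
  ultimately show ?case using 0(8)[of v] 0(2) by simp
next
  case (Suc D)
  define L where "L = {ks. set ks \<subseteq> {..<m} \<and> length ks = D}"
  define g where "g j v = (\<Sum>ks\<in>L. c (j # ks) * tower_monomial f ks v)" for j v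
  have L: "{ks. set ks \<subseteq> {..<m} \<and> length ks = Suc D} = (\<lambda>(xs, k). k # xs) ` (L \<times> {..<m})"
    unfolding L_def by (rule lists_length_Suc_eq)
  have inj: "inj_on (\<lambda>(xs, k). k # xs) (L \<times> {..<m})" by (auto simp: inj_on_def)
  have sum_eq: "(\<Sum>ks | set ks \<subseteq> {..<m} \<and> length ks = Suc D. c ks * tower_monomial f ks v) =
      (\<Sum>j<m. f D v ^ j * g j v)" for v
  proof -
    have "(\<Sum>ks | set ks \<subseteq> {..<m} \<and> length ks = Suc D. c ks * tower_monomial f ks v) =
      (\<Sum>(xs, k)\<in>L \<times> {..<m}. c (k # xs) * tower_monomial f (k # xs) v)"
      unfolding L by (subst sum.reindex[OF inj]) (auto intro!: sum.cong)
    also have "\<dots> = (\<Sum>xs\<in>L. \<Sum>k<m. c (k # xs) * tower_monomial f (k # xs) v)"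
      by (rule sum.cartesian_product[symmetric])
    also have "\<dots> = (\<Sum>k<m. \<Sum>xs\<in>L. c (k # xs) * tower_monomial f (k # xs) v)"
      by (rule sum.swap)
    also have "\<dots> = (\<Sum>j<m. f D v ^ j * g j v)"
      unfolding g_def sum_distrib_left
      by (intro sum.cong refl) (auto simp: L_def mult_ac)
    finally show ?thesis .
  qed
  \<comment> \<open>Used twice: a coefficient \<open>g j\<close> vanishing on \<open>Z D\<close> has
    only zero scalars and so vanishes on \<open>Z (Suc D)\<close> too; at the end the same fact
    gives the claim.\<close>
  have coeffs: "c (j # ks) = 0" if "\<And>v. v \<in> Z D \<Longrightarrow> g j v = 0" "ks \<in> L" for j ks
    by (rule Suc.IH[where c = "\<lambda>ks. c (j # ks)"])
      (use that Suc.prems in \<open>auto simp: g_def L_def\<close>)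
  have "g j v = 0" if "j < m" "v \<in> Z D" for j v
  proof (rule vanishing_power_series[where Z = "Z (Suc D)" and Z' = "Z D" and f = "f D" and m = m and g = g])
    show "irreducible_variety n (Z (Suc D))" "Z D \<subseteq> Z (Suc D)" "f D \<in> poly_funs n"
      "\<exists>v\<in>Z (Suc D). f D v \<noteq> 0" using Suc.prems by auto
    show "f D v = 0" if "v \<in> Z D" for v using Suc.prems that by auto
    show "g j \<in> poly_funs n" for j
      unfolding g_def using Suc.prems
      by (intro poly_funs_sum poly_funs.mult poly_funs.const tower_monomial_poly_fun) (auto simp: L_def)
    show "g j v = 0" if "\<And>v. v \<in> Z D \<Longrightarrow> g j v = 0" for j v
      using coeffs[OF that] by (simp add: g_def)
    show "(\<Sum>j<m. f D v ^ j * g j v) = 0" if "v \<in> Z (Suc D)" for v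
      using Suc.prems(8)[OF that] sum_eq by simp
  qed (use that in auto)
  then have "c (j # ks) = 0" if "j < m" "ks \<in> L" for j ks using coeffs that by blast
  then show ?case using Suc.prems(1,2) by (cases ks) (auto simp: L_def)
qed

text \<open>For \<open>m > 0\<close> the right side is at most \<open>B * m ^ E\<close> with
  \<open>B = K * (e + 1) ^ E\<close>. If \<open>D\<close> exceeded \<open>E\<close>, the left side
  would be at least \<open>m ^ E * m\<close>, which is larger for \<open>m = B + 1\<close>.\<close>

lemma polynomial_growth_exponent:
  fixes K e D E :: nat
  assumes "\<And>m. m ^ D \<le> K * (e * m + 1) ^ E"
  shows "D \<le> E"
proof (rule ccontr)
  assume "\<not> D \<le> E"
  then obtain r where D: "D = E + Suc r" by (metis less_imp_Suc_add not_le add_Suc_right)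
  define B where "B = K * (e + 1) ^ E"
  define m where "m = B + 1"
  have m: "m > 0" by (simp add: m_def)
  have "m ^ E * m \<le> m ^ D" using m by (simp add: D power_add)
  also have "\<dots> \<le> K * (e * m + 1) ^ E" by (rule assms)
  also have "\<dots> \<le> K * ((e + 1) * m) ^ E"
    using m by (intro mult_left_mono power_mono) (auto simp: algebra_simps)
  also have "\<dots> = m ^ E * B" unfolding power_mult_distrib by (simp add: B_def)
  finally show False using m by (simp add: m_def)
qed

text \<open>The \<open>m ^ D\<close> tower monomials with exponents below \<open>m\<close> are
  independent on \<open>X\<close> and of degree at most \<open>D * E * m\<close>. Reduction puts
  them in the span of the reduced monomials, whose number grows at most like
  \<open>m ^ (card G - s)\<close>.\<close>

lemma chain_length_le:
  fixes X :: "'a::idom vec set"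
  assumes G: "finite G" and H: "H \<subseteq> G"
    and ab: "\<And>i. i < s \<Longrightarrow> a i \<in> G - H \<and> b i \<in> G - H"
    and inj: "inj_on a {..<s}" "inj_on b {..<s}" and disj: "a ` {..<s} \<inter> b ` {..<s} = {}"
    and rel: "\<And>i. i < s \<Longrightarrow> comb_on X (\<lambda>(h,g) v. val h v * val g v) (H \<times> G) (\<lambda>v. val (a i) v * val (b i) v)"
    and coord: "\<And>i. i < n \<Longrightarrow> comb_on X val G (\<lambda>v. v $ i)"
    and irr: "\<And>i. i \<le> D \<Longrightarrow> irreducible_variety n (Z i)"
    and chain: "\<And>i. i < D \<Longrightarrow> Z i \<subset> Z (Suc i)" and ZX: "Z D \<subseteq> X"
  shows "D \<le> card G - s"
proof -
  \<comment> \<open>A point of the larger variety outside the smaller one violates one of the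
    equations of the smaller one.\<close>
  have "\<exists>f\<in>poly_funs n. (\<forall>v\<in>Z i. f v = 0) \<and> (\<exists>v\<in>Z (Suc i). f v \<noteq> 0)" if iD: "i < D" for i
  proof -
    obtain P where P: "P \<subseteq> poly_funs n" "Z i = {v \<in> carrier_vec n. \<forall>p\<in>P. p v = 0}"
      using irreducible_variety_zero_set[OF irr[OF less_imp_le[OF iD]]] by blast
    obtain z where z: "z \<in> Z (Suc i)" "z \<notin> Z i" using chain[OF iD] by blast
    have "z \<in> carrier_vec n"
      using irreducible_variety_zero_set[OF irr[of "Suc i"]] iD z by fastforce
    then obtain p where "p \<in> P" "p z \<noteq> 0" using P z by auto
    then show ?thesis using P z by blast
  qed
  then obtain f where f: "\<And>i. i < D \<Longrightarrow> f i \<in> poly_funs n" "\<And>i v. i < D \<Longrightarrow> v \<in> Z i \<Longrightarrow> f i v = 0"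
      "\<And>i. i < D \<Longrightarrow> \<exists>v\<in>Z (Suc i). f i v \<noteq> 0" by metis
  have "\<exists>e. comb_on X (gen_monomial val) (multisets_upto G e) (f i)" if "i < D" for i
    using poly_fun_comb_on[OF G coord f(1)[OF that]] .
  then obtain e where e: "\<And>i. i < D \<Longrightarrow> comb_on X (gen_monomial val) (multisets_upto G (e i)) (f i)"
    by metis
  define E where "E = (\<Sum>i<D. e i)"
  have E: "comb_on X (gen_monomial val) (multisets_upto G E) (f i)" if "i < D" for i
    using member_le_sum[of i "{..<D}" e] that
    by (intro comb_on_multisets_mono[OF G _ e[OF that]]) (auto simp: E_def)
  have tower: "comb_on X (gen_monomial val) (multisets_upto G (length ks * (m * E))) (tower_monomial f ks)"
    if "set ks \<subseteq> {..<m}" "length ks \<le> D" for ks m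
    using that
  proof (induction ks)
    case Nil
    then show ?case using comb_on_multisets_one[OF G] by (simp cong: comb_on_cong)
  next
    case (Cons k ks)
    have "comb_on X (gen_monomial val) (multisets_upto G (k * E)) (\<lambda>v. f (length ks) v ^ k)"
      using Cons.prems by (intro comb_on_multisets_power G E) auto
    then have "comb_on X (gen_monomial val) (multisets_upto G (m * E)) (\<lambda>v. f (length ks) v ^ k)"
      by (rule comb_on_multisets_mono[OF G, rotated]) (use Cons.prems in auto)
    from comb_on_multisets_mult[OF G this Cons.IH] Cons.prems
    have "comb_on X (gen_monomial val) (multisets_upto G (m * E + length ks * (m * E)))
      (tower_monomial f (k # ks))" by (simp cong: comb_on_cong)
    then show ?case by (simp del: tower_monomial.simps)
  qed
  have ab': "a i \<in> G - H \<and> b i \<in> G - H \<and> a i \<noteq> b i" if "i < s" for i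
    using ab[OF that] disj that by blast
  have "m ^ D \<le> 2 ^ s * (D * E * m + 1) ^ (card G - s)" for m
  proof -
    let ?L = "{ks. set ks \<subseteq> {..<m} \<and> length ks = D}"
    let ?d = "D * (m * E)"
    let ?R = "reduced_multisets G a b s ?d"
    have "card ?L \<le> card ?R"
    proof (rule comb_on_card_le)
      show "finite ?L" by (rule finite_lists_length_eq) simp
      show "finite ?R" using finite_multisets_upto[OF G] by (simp add: reduced_multisets_def)
      show "comb_on X (gen_monomial val) ?R (tower_monomial f ks)" if "ks \<in> ?L" for ks
      proof (rule comb_on_trans[OF tower])
        show "comb_on X (gen_monomial val) ?R (gen_monomial val M)"
          if "M \<in> multisets_upto G (length ks * (m * E))" for M
          using that \<open>ks \<in> ?L\<close> by (intro reduce_monomial[OF G H ab' rel]) simp_all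
      qed (use that in auto)
      show "\<forall>ks\<in>?L. c ks = 0" if z: "\<And>v. v \<in> X \<Longrightarrow> (\<Sum>ks\<in>?L. c ks * tower_monomial f ks v) = 0" for c
      proof
        fix ks assume ks: "ks \<in> ?L"
        have zD: "(\<Sum>ks\<in>?L. c ks * tower_monomial f ks v) = 0" if "v \<in> Z D" for v
          using that z ZX by blast
        show "c ks = 0"
          by (rule tower_monomials_independent[where D = D and n = n and Z = Z and f = f and m = m,
                OF irr less_imp_le[OF chain] f])
            (use ks zD in auto)
      qed
    qed
    also have "card ?R \<le> 2 ^ s * (?d + 1) ^ (card G - s)"
      using ab by (intro card_reduced_multisets G inj disj) auto
    finally show ?thesis by (simp add: card_lists_length_eq mult_ac)
  qed
  then show ?thesis by (rule polynomial_growth_exponent)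
qed

section \<open>Subrank and geometric rank\<close>

lemma tensor_eval_unit_vec:
  assumes "k < n3"
  shows "tensor_eval n1 n2 n3 T x y (unit_vec n3 k) = (\<Sum>i<n1. \<Sum>j<n2. T i j k * x $ i * y $ j)"
  unfolding tensor_eval_def using assms
  by (intro sum.cong refl)
     (simp add: unit_vec_def if_distrib[of "\<lambda>z. _ * z"] cong: if_cong)

lemma tensor_variety_iff:
  "v \<in> tensor_variety n1 n2 n3 T \<longleftrightarrow> v \<in> carrier_vec (n1 + n2) \<and>
    (\<forall>k<n3. (\<Sum>i<n1. \<Sum>j<n2. T i j k * v $ i * v $ (n1 + j)) = 0)"
proof -
  have *: "tensor_contract n1 n2 n3 T x y = 0\<^sub>v n3 \<longleftrightarrow>
      (\<forall>k<n3. (\<Sum>i<n1. \<Sum>j<n2. T i j k * (x @\<^sub>v y) $ i * (x @\<^sub>v y) $ (n1 + j)) = 0)"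
    if "x \<in> carrier_vec n1" "y \<in> carrier_vec n2" for x y
    using that by (auto simp: tensor_contract_def vec_eq_iff tensor_eval_unit_vec)
  show ?thesis
  proof
    assume "v \<in> tensor_variety n1 n2 n3 T"
    then show "v \<in> carrier_vec (n1 + n2) \<and>
      (\<forall>k<n3. (\<Sum>i<n1. \<Sum>j<n2. T i j k * v $ i * v $ (n1 + j)) = 0)"
      unfolding tensor_variety_def using * by auto
  next
    assume v: "v \<in> carrier_vec (n1 + n2) \<and>
      (\<forall>k<n3. (\<Sum>i<n1. \<Sum>j<n2. T i j k * v $ i * v $ (n1 + j)) = 0)"
    then have "v = vec_first v n1 @\<^sub>v vec_last v n2" by simp
    moreover have "tensor_contract n1 n2 n3 T (vec_first v n1) (vec_last v n2) = 0\<^sub>v n3"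
      by (subst *) (use v in auto)
    ultimately show "v \<in> tensor_variety n1 n2 n3 T"
      unfolding tensor_variety_def by (intro CollectI exI[of _ "vec_first v n1"] exI[of _ "vec_last v n2"]) auto
  qed
qed

text \<open>Change of coordinates: on combinations of rows, a bilinear form is given by its values
  on pairs of rows.\<close>

lemma bilinear_expand:
  fixes M :: "nat \<Rightarrow> nat \<Rightarrow> 'a::comm_ring_1"
  shows "(\<Sum>p<n1. \<Sum>q<n2. M p q * (\<Sum>i<s. a i * A i p) * (\<Sum>j<t. b j * B j q)) =
    (\<Sum>i<s. \<Sum>j<t. a i * b j * (\<Sum>p<n1. \<Sum>q<n2. A i p * B j q * M p q))"
proof -
  have "(\<Sum>p<n1. \<Sum>q<n2. M p q * (\<Sum>i<s. a i * A i p) * (\<Sum>j<t. b j * B j q)) =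
    (\<Sum>p<n1. \<Sum>q<n2. \<Sum>i<s. \<Sum>j<t. a i * b j * (A i p * B j q * M p q))"
    by (simp add: sum_product sum_distrib_left mult_ac)
  also have "\<dots> = (\<Sum>p<n1. \<Sum>i<s. \<Sum>j<t. \<Sum>q<n2. a i * b j * (A i p * B j q * M p q))"
    by (intro sum.cong refl) (subst sum.swap, intro sum.cong refl, rule sum.swap)
  also have "\<dots> = (\<Sum>i<s. \<Sum>j<t. \<Sum>p<n1. \<Sum>q<n2. a i * b j * (A i p * B j q * M p q))"
    by (subst sum.swap) (intro sum.cong refl, rule sum.swap)
  finally show ?thesis by (simp add: sum_distrib_left)
qed

text \<open>Pairing a relation with the dual vector \<open>W j\<close> isolates the coefficient
  \<open>u j\<close>.\<close>

lemma dual_family_independent: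
  fixes A :: "nat \<Rightarrow> nat \<Rightarrow> 'a::comm_ring_1"
  assumes dual: "\<And>i j. i < s \<Longrightarrow> j < s \<Longrightarrow> (\<Sum>p<n. A i p * W j p) = (if i = j then 1 else 0)"
    and z: "\<And>p. p \<in> {..<n} \<Longrightarrow> (\<Sum>i<s. u i * A i p) = 0"
  shows "\<forall>i\<in>{..<s}. u i = 0"
proof
  fix j assume j: "j \<in> {..<s}"
  have "u j = (\<Sum>i<s. u i * (if i = j then 1 else 0))"
    using j by (simp add: if_distrib[of "\<lambda>z. _ * z"] cong: if_cong)
  also have "\<dots> = (\<Sum>i<s. \<Sum>p<n. (u i * A i p) * W j p)"
    using j by (intro sum.cong refl) (simp add: dual[symmetric] sum_distrib_left mult.assoc)
  also have "\<dots> = (\<Sum>p<n. (\<Sum>i<s. u i * A i p) * W j p)"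
    by (subst sum.swap) (simp add: sum_distrib_right)
  also have "\<dots> = 0" using z by simp
  finally show "u j = 0" .
qed

text \<open>
  The relation \<open>\<Sum>k. C i k * T(x,y,e k) = 0\<close> expresses the product of the \<open>i\<close>-th coordinates of \<open>x\<close>
  along the rows of \<open>A\<close> and of \<open>y\<close> along the rows of \<open>B\<close> through products with a coordinate in
  a complementary direction.
\<close>

lemma unit_tensor_le_bounds:
  fixes T :: "'a::field tensor"
  assumes le: "tensor_le s s s unit_tensor n1 n2 n3 T"
  shows "s \<le> n1"
    and "(\<And>i. i \<le> D \<Longrightarrow> irreducible_variety (n1 + n2) (Z i)) \<Longrightarrow> (\<And>i. i < D \<Longrightarrow> Z i \<subset> Z (Suc i)) \<Longrightarrow>
      Z D \<subseteq> tensor_variety n1 n2 n3 T \<Longrightarrow> D + s \<le> n1 + n2"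
proof -
  obtain A' B' C where le': "tensor_eq s s s unit_tensor (tensor_act n1 n2 n3 A' B' C T)"
    using le unfolding tensor_le_def by blast
  define A where "A i p = A' $$ (i, p)" for i p
  define B where "B i p = B' $$ (i, p)" for i p
  \<comment> \<open>\<open>M i\<close> is the bilinear form obtained by contracting the third index
    of \<open>T\<close> with row \<open>i\<close> of \<open>C\<close>. On pairs of rows of
    \<open>A\<close> and \<open>B\<close> these forms take the entries of the unit tensor.\<close>
  define M where "M i p q = (\<Sum>k<n3. C $$ (i, k) * T p q k)" for i p q
  have unit: "(\<Sum>p<n1. \<Sum>q<n2. A i p * B j q * M k p q) = (if i = j \<and> j = k then 1 else 0)"
    if "i < s" "j < s" "k < s" for i j k
  proof -
    have "(\<Sum>p<n1. \<Sum>q<n2. A i p * B j q * M k p q) = tensor_act n1 n2 n3 A' B' C T i j k"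
      unfolding tensor_act_def A_def B_def M_def by (simp add: sum_distrib_left mult_ac)
    also have "\<dots> = unit_tensor i j k" using le' that by (simp add: tensor_eq_def)
    finally show ?thesis by (simp add: unit_tensor_def)
  qed
  \<comment> \<open>Row \<open>j\<close> of \<open>B\<close> inserted into the form
    \<open>M j\<close> is the dual vector to row \<open>j\<close> of \<open>A\<close>; the roles are
    exchanged for \<open>indB\<close>.\<close>
  have indA: "\<forall>i\<in>{..<s}. u i = 0" if "\<And>p. p \<in> {..<n1} \<Longrightarrow> (\<Sum>i<s. u i * A i p) = 0" for u
  proof (rule dual_family_independent[OF _ that])
    show "(\<Sum>p<n1. A i p * (\<Sum>q<n2. B j q * M j p q)) = (if i = j then 1 else 0)"
      if "i < s" "j < s" for i j
      using unit[OF that that(2)] by (simp add: sum_distrib_left mult.assoc)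
  qed
  have indB: "\<forall>i\<in>{..<s}. u i = 0" if "\<And>p. p \<in> {..<n2} \<Longrightarrow> (\<Sum>i<s. u i * B i p) = 0" for u
  proof (rule dual_family_independent[OF _ that])
    show "(\<Sum>q<n2. B i q * (\<Sum>p<n1. A j p * M j p q)) = (if i = j then 1 else 0)"
      if "i < s" "j < s" for i j
    proof -
      have "(\<Sum>q<n2. B i q * (\<Sum>p<n1. A j p * M j p q)) = (\<Sum>p<n1. \<Sum>q<n2. A j p * B i q * M j p q)"
        by (subst sum.swap) (simp add: sum_distrib_left mult_ac)
      then show ?thesis using unit[OF that(2,1,2)] by auto
    qed
  qed
  obtain J1 where J1: "J1 \<subseteq> {..<n1}" "card J1 + s = n1"
    and ex1: "\<forall>x. \<exists>a b. \<forall>c\<in>{..<n1}. x c = (\<Sum>i<s. a i * A i c) + (if c \<in> J1 then b c else 0)"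
    using steinitz_coordinates[of "{..<s}" "{..<n1}" A, OF finite_lessThan finite_lessThan indA] by auto
  obtain J2 where J2: "J2 \<subseteq> {..<n2}" "card J2 + s = n2"
    and ex2: "\<forall>x. \<exists>a b. \<forall>c\<in>{..<n2}. x c = (\<Sum>i<s. a i * B i c) + (if c \<in> J2 then b c else 0)"
    using steinitz_coordinates[of "{..<s}" "{..<n2}" B, OF finite_lessThan finite_lessThan indB] by auto
  show "s \<le> n1" using J1 by simp
  \<comment> \<open>Coefficients are chosen for each vector separately; only the resulting pointwise
    identities are used.\<close>
  from ex1 obtain a1 b1 where
    1: "\<And>x p. p < n1 \<Longrightarrow> x p = (\<Sum>i<s. a1 x i * A i p) + (if p \<in> J1 then b1 x p else 0)"
    unfolding lessThan_iff Ball_def by metis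
  from ex2 obtain a2 b2 where
    2: "\<And>y q. q < n2 \<Longrightarrow> y q = (\<Sum>i<s. a2 y i * B i q) + (if q \<in> J2 then b2 y q else 0)"
    unfolding lessThan_iff Ball_def by metis
  define x :: "'a vec \<Rightarrow> nat \<Rightarrow> 'a" where "x v p = v $ p" for v p
  define y :: "'a vec \<Rightarrow> nat \<Rightarrow> 'a" where "y v q = v $ (n1 + q)" for v q
  \<comment> \<open>Tags keep the generators distinct: \<open>Inl\<close> for coordinates along the
    rows of \<open>A\<close> and \<open>B\<close>, \<open>Inr\<close> for the complementary ones,
    which form \<open>H\<close>.\<close>
  define val :: "(nat + nat) + (nat + nat) \<Rightarrow> 'a vec \<Rightarrow> 'a" where
    "val = case_sum (case_sum (\<lambda>i v. a1 (x v) i) (\<lambda>i v. a2 (y v) i))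
                    (case_sum (\<lambda>p v. b1 (x v) p) (\<lambda>q v. b2 (y v) q))"
  define G where "G = ({..<s} <+> {..<s}) <+> (J1 <+> J2)"
  define H :: "((nat + nat) + (nat + nat)) set" where "H = {} <+> (J1 <+> J2)"
  let ?X = "tensor_variety n1 n2 n3 T"
  let ?quad = "\<lambda>(h,g) v. val h v * val g v"
  have finJ: "finite J1" "finite J2" using J1 J2 finite_subset by auto
  have G: "finite G" and H: "finite H" "H \<subseteq> G" unfolding G_def H_def using finJ by auto
  \<comment> \<open>The count is \<open>2 * s\<close> plus the complements of size
    \<open>n1 - s\<close> and \<open>n2 - s\<close>.\<close>
  have cardG: "card G = n1 + n2"
    unfolding G_def using finJ J1 J2 by (simp add: card_Plus)
  define xA where "xA v p = (\<Sum>i<s. a1 (x v) i * A i p)" for v p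
  define yB where "yB v q = (\<Sum>i<s. a2 (y v) i * B i q)" for v q
  define x' where "x' v p = (if p \<in> J1 then b1 (x v) p else 0)" for v p
  define y' where "y' v q = (if q \<in> J2 then b2 (y v) q else 0)" for v q
  have xsplit: "x v p = xA v p + x' v p" if "p < n1" for v p
    using 1[OF that, of "x v"] by (simp add: xA_def x'_def)
  have ysplit: "y v q = yB v q + y' v q" if "q < n2" for v q
    using 2[OF that, of "y v"] by (simp add: yB_def y'_def)
  have cx': "comb_on ?X val H (\<lambda>v. x' v p)" for p
  proof (cases "p \<in> J1")
    case True
    then show ?thesis
      using comb_on_base[OF H(1), of "Inr (Inl p)" ?X val] by (auto simp: H_def val_def x'_def)
  qed (simp add: x'_def comb_on_zero)
  have cy': "comb_on ?X val H (\<lambda>v. y' v q)" for q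
  proof (cases "q \<in> J2")
    case True
    then show ?thesis
      using comb_on_base[OF H(1), of "Inr (Inr q)" ?X val] by (auto simp: H_def val_def y'_def)
  qed (simp add: y'_def comb_on_zero)
  have HG: "comb_on ?X val G f" if "comb_on ?X val H f" for f
    using that by (rule comb_on_trans) (use H in \<open>auto intro: comb_on_base[OF G]\<close>)
  have cxA: "comb_on ?X val G (\<lambda>v. xA v p)" for p
  proof -
    have "comb_on ?X val G (\<lambda>v. a1 (x v) i)" if "i < s" for i
      using comb_on_base[OF G, of "Inl (Inl i)" ?X val] that by (auto simp: G_def val_def)
    then have "comb_on ?X val G (\<lambda>v. \<Sum>i<s. A i p * a1 (x v) i)"
      by (intro comb_on_sum comb_on_scale) auto
    then show ?thesis by (simp add: xA_def mult.commute)
  qed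
  have cyB: "comb_on ?X val G (\<lambda>v. yB v q)" for q
  proof -
    have "comb_on ?X val G (\<lambda>v. a2 (y v) i)" if "i < s" for i
      using comb_on_base[OF G, of "Inl (Inr i)" ?X val] that by (auto simp: G_def val_def)
    then have "comb_on ?X val G (\<lambda>v. \<Sum>i<s. B i q * a2 (y v) i)"
      by (intro comb_on_sum comb_on_scale) auto
    then show ?thesis by (simp add: yB_def mult.commute)
  qed
  have cx: "comb_on ?X val G (\<lambda>v. x v p)" if "p < n1" for p
    using comb_on_add[OF cxA HG[OF cx']] xsplit[OF that] by simp
  have cy: "comb_on ?X val G (\<lambda>v. y v q)" if "q < n2" for q
    using comb_on_add[OF cyB HG[OF cy']] ysplit[OF that] by simp
  have coord: "comb_on ?X val G (\<lambda>v. v $ i)" if "i < n1 + n2" for i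
  proof (cases "i < n1")
    case True
    then show ?thesis using cx[of i] by (simp add: x_def)
  next
    case False
    then show ?thesis using cy[of "i - n1"] that by (simp add: y_def)
  qed
  have cHG: "comb_on ?X ?quad (H \<times> G) (\<lambda>v. f v * g v)"
    if "comb_on ?X val H f" "comb_on ?X val G g" for f g
    using that
  proof (rule comb_on_mult)
    fix h g assume "h \<in> H" "g \<in> G"
    then show "comb_on ?X ?quad (H \<times> G) (\<lambda>v. val h v * val g v)"
      using comb_on_base[of "H \<times> G" "(h, g)" ?X ?quad] H G by simp
  qed
  have rel: "comb_on ?X ?quad (H \<times> G) (\<lambda>v. val (Inl (Inl i)) v * val (Inl (Inr i)) v)" if i: "i < s" for i
  proof -
    have eq: "a1 (x v) i * a2 (y v) i =
        (\<Sum>p<n1. \<Sum>q<n2. - M i p q * (y' v q * xA v p)) + (\<Sum>p<n1. \<Sum>q<n2. - M i p q * (x' v p * y v q))"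
      if v: "v \<in> ?X" for v
    proof -
      have neg: "P = - Q + - R" if "0 = P + Q + R" for P Q R :: 'a
      proof -
        have "P + (Q + R) = 0" using that by (simp only: add.assoc)
        then have "P = - (Q + R)" by (rule eq_neg_iff_add_eq_0[THEN iffD2])
        then show ?thesis by simp
      qed
      have "0 = (\<Sum>k<n3. C $$ (i, k) * (\<Sum>p<n1. \<Sum>q<n2. T p q k * x v p * y v q))"
        using v by (simp add: tensor_variety_iff x_def y_def)
      also have "\<dots> = (\<Sum>k<n3. \<Sum>p<n1. \<Sum>q<n2. C $$ (i, k) * T p q k * x v p * y v q)"
        by (simp add: sum_distrib_left mult_ac)
      also have "\<dots> = (\<Sum>p<n1. \<Sum>k<n3. \<Sum>q<n2. C $$ (i, k) * T p q k * x v p * y v q)"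
        by (rule sum.swap)
      also have "\<dots> = (\<Sum>p<n1. \<Sum>q<n2. \<Sum>k<n3. C $$ (i, k) * T p q k * x v p * y v q)"
        by (rule sum.cong[OF refl], rule sum.swap)
      also have "\<dots> = (\<Sum>p<n1. \<Sum>q<n2. M i p q * x v p * y v q)"
        by (simp add: M_def sum_distrib_right)
      \<comment> \<open>Both arguments are split, but \<open>y\<close> stays whole in the last
        group, so that each of the two correction terms carries a factor \<open>y'\<close> or
        \<open>x'\<close> in the span of \<open>H\<close>.\<close>
      also have "\<dots> = (\<Sum>p<n1. \<Sum>q<n2. M i p q * xA v p * yB v q
          + M i p q * (y' v q * xA v p) + M i p q * (x' v p * y v q))"
        by (intro sum.cong refl) (simp add: xsplit ysplit algebra_simps)
      also have "\<dots> = (\<Sum>p<n1. \<Sum>q<n2. M i p q * xA v p * yB v q)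
          + (\<Sum>p<n1. \<Sum>q<n2. M i p q * (y' v q * xA v p)) + (\<Sum>p<n1. \<Sum>q<n2. M i p q * (x' v p * y v q))"
        by (simp only: sum.distrib)
      finally have diag: "(\<Sum>p<n1. \<Sum>q<n2. M i p q * xA v p * yB v q) =
        (\<Sum>p<n1. \<Sum>q<n2. - M i p q * (y' v q * xA v p)) + (\<Sum>p<n1. \<Sum>q<n2. - M i p q * (x' v p * y v q))"
        unfolding mult_minus_left sum_negf by (rule neg)
      have "(\<Sum>p<n1. \<Sum>q<n2. M i p q * xA v p * yB v q) =
        (\<Sum>i'<s. \<Sum>j<s. a1 (x v) i' * a2 (y v) j * (if i' = j \<and> j = i then 1 else 0))"
        unfolding xA_def yB_def bilinear_expand using i by (intro sum.cong refl) (simp add: unit)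
      also have "\<dots> = (\<Sum>i'<s. if i' = i then a1 (x v) i * a2 (y v) i else 0)"
      proof (rule sum.cong[OF refl])
        fix i'
        have "(\<Sum>j<s. a1 (x v) i' * a2 (y v) j * (if i' = j \<and> j = i then 1 else 0)) =
          (\<Sum>j<s. if j = i then if i' = i then a1 (x v) i * a2 (y v) i else 0 else 0)"
          by (rule sum.cong) auto
        then show "(\<Sum>j<s. a1 (x v) i' * a2 (y v) j * (if i' = j \<and> j = i then 1 else 0)) =
          (if i' = i then a1 (x v) i * a2 (y v) i else 0)" using i by simp
      qed
      also have "\<dots> = a1 (x v) i * a2 (y v) i" using i by simp
      finally show ?thesis using diag by (simp only:)
    qed
    have "comb_on ?X ?quad (H \<times> G) (\<lambda>v. (\<Sum>p<n1. \<Sum>q<n2. - M i p q * (y' v q * xA v p)) +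
        (\<Sum>p<n1. \<Sum>q<n2. - M i p q * (x' v p * y v q)))"
    proof (rule comb_on_add)
      show "comb_on ?X ?quad (H \<times> G) (\<lambda>v. \<Sum>p<n1. \<Sum>q<n2. - M i p q * (y' v q * xA v p))"
        by (rule comb_on_sum, rule comb_on_sum, rule comb_on_scale, rule cHG[OF cy' cxA])
      show "comb_on ?X ?quad (H \<times> G) (\<lambda>v. \<Sum>p<n1. \<Sum>q<n2. - M i p q * (x' v p * y v q))"
        by (rule comb_on_sum, rule comb_on_sum, rule comb_on_scale, rule cHG[OF cx' cy]) simp
    qed
    then have "comb_on ?X ?quad (H \<times> G) (\<lambda>v. a1 (x v) i * a2 (y v) i)"
      by (subst comb_on_cong[OF eq])
    then show ?thesis unfolding val_def sum.case .
  qed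
  assume irr: "\<And>i. i \<le> D \<Longrightarrow> irreducible_variety (n1 + n2) (Z i)"
    and chain: "\<And>i. i < D \<Longrightarrow> Z i \<subset> Z (Suc i)" and ZX: "Z D \<subseteq> ?X"
  have "D \<le> card G - s"
    by (rule chain_length_le[where val = val and a = "\<lambda>i. Inl (Inl i)" and b = "\<lambda>i. Inl (Inr i)",
          OF G H(2) _ _ _ _ rel coord irr chain ZX])
       (auto simp: G_def H_def inj_on_def)
  \<comment> \<open>Here \<open>s \<le> n1\<close> makes the truncated difference
    \<open>card G - s\<close> exact.\<close>
  then show "D + s \<le> n1 + n2" using cardG J1 by simp
qed

section \<open>Parametrized varieties\<close>

text \<open>In a finite field, 1 plus the product of all linear factors would be a nonconstant
  polynomial without roots.\<close>

lemma infinite_UNIV_alg_closed_field: "infinite (UNIV :: 'a::alg_closed_field set)"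
proof
  assume fin: "finite (UNIV :: 'a set)"
  define p :: "'a poly" where "p = (\<Prod>a\<in>UNIV. [:- a, 1:])"
  have "degree p = card (UNIV :: 'a set)"
    unfolding p_def by (subst degree_prod_eq_sum_degree) auto
  then have "degree p > 0" using fin by (simp add: card_gt_0_iff)
  then have "degree (p + 1) > 0" by (subst degree_add_eq_left) auto
  then obtain x where "poly (p + 1) x = 0" using alg_closed_imp_poly_has_root by blast
  moreover have "poly p x = 0" unfolding p_def poly_prod using fin by (auto simp: prod_zero_iff)
  ultimately show False by simp
qed

lemma poly_fun_on_line:
  assumes "f \<in> poly_funs n"
  shows "\<exists>q. \<forall>t. f (vec n (\<lambda>j. a j + t * b j)) = poly q t"
  using assms
proof (induction rule: poly_funs.induct)
  case (const c)
  show ?case by (rule exI[of _ "[:c:]"]) simp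
next
  case (coord i)
  then show ?case by (intro exI[of _ "[:a i, b i:]"]) (simp add: algebra_simps)
next
  case (add p q)
  then obtain P Q where "\<forall>t. p (vec n (\<lambda>j. a j + t * b j)) = poly P t"
    "\<forall>t. q (vec n (\<lambda>j. a j + t * b j)) = poly Q t" by blast
  then show ?case by (intro exI[of _ "P + Q"]) simp
next
  case (mult p q)
  then obtain P Q where "\<forall>t. p (vec n (\<lambda>j. a j + t * b j)) = poly P t"
    "\<forall>t. q (vec n (\<lambda>j. a j + t * b j)) = poly Q t" by blast
  then show ?case by (intro exI[of _ "P * Q"]) simp
qed

text \<open>The one property of affine subspaces that the arguments below rely on.\<close>

definition line_closed :: "nat \<Rightarrow> 'a::comm_ring_1 vec set \<Rightarrow> bool" where
  "line_closed n L \<longleftrightarrow> L \<subseteq> carrier_vec n \<and>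
     (\<forall>a\<in>L. \<forall>b\<in>L. \<forall>t. vec n (\<lambda>j. a $ j + t * (b $ j - a $ j)) \<in> L)"

text \<open>On the line joining a point where \<open>f\<close> is nonzero to one where
  \<open>g\<close> is nonzero, both restrict to nonzero univariate polynomials. Their product has
  finitely many roots, while the field is infinite.\<close>

lemma poly_funs_domain:
  fixes L :: "'a::alg_closed_field vec set"
  assumes L: "line_closed n L" and f: "f \<in> poly_funs n" "\<exists>v\<in>L. f v \<noteq> 0"
    and g: "g \<in> poly_funs n" "\<exists>v\<in>L. g v \<noteq> 0"
  shows "\<exists>v\<in>L. f v * g v \<noteq> 0"
proof -
  obtain a b where a: "a \<in> L" "f a \<noteq> 0" and b: "b \<in> L" "g b \<noteq> 0" using f g by blast
  define l where "l t = vec n (\<lambda>j. a $ j + t * (b $ j - a $ j))" for t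
  have "a \<in> carrier_vec n" "b \<in> carrier_vec n" using L a b by (auto simp: line_closed_def)
  then have l: "l 0 = a" "l 1 = b" by (auto simp: l_def)
  have lL: "l t \<in> L" for t using L a b by (auto simp: line_closed_def l_def)
  obtain p where p: "\<And>t. f (l t) = poly p t"
    using poly_fun_on_line[OF f(1), of "\<lambda>j. a $ j" "\<lambda>j. b $ j - a $ j"] unfolding l_def by blast
  obtain q where q: "\<And>t. g (l t) = poly q t"
    using poly_fun_on_line[OF g(1), of "\<lambda>j. a $ j" "\<lambda>j. b $ j - a $ j"] unfolding l_def by blast
  have "p \<noteq> 0" "q \<noteq> 0" using p[of 0] q[of 1] l a b by auto
  then have "finite {t. poly (p * q) t = 0}" by (intro poly_roots_finite) simp
  then have "{t. poly (p * q) t = 0} \<noteq> UNIV"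
    using infinite_UNIV_alg_closed_field[where 'a = 'a] by metis
  then obtain t where "poly (p * q) t \<noteq> 0" by blast
  then have "f (l t) * g (l t) \<noteq> 0" using p q by simp
  with lL show ?thesis by blast
qed

section \<open>Zariski closures of polynomial images\<close>

definition zariski_closure :: "nat \<Rightarrow> 'a::comm_ring_1 vec set \<Rightarrow> 'a vec set" where
  "zariski_closure n S = {z \<in> carrier_vec n. \<forall>p\<in>poly_funs n. (\<forall>v\<in>S. p v = 0) \<longrightarrow> p z = 0}"

lemma zariski_closure_superset: "S \<subseteq> carrier_vec n \<Longrightarrow> S \<subseteq> zariski_closure n S"
  by (auto simp: zariski_closure_def)

lemma zariski_closure_mono: "S \<subseteq> S' \<Longrightarrow> zariski_closure n S \<subseteq> zariski_closure n S'"
  by (auto simp: zariski_closure_def dest: subsetD)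

lemma affine_variety_zariski_closure: "affine_variety n (zariski_closure n S)"
  unfolding affine_variety_def zariski_closure_def
  by (rule exI[of _ "{p \<in> poly_funs n. \<forall>v\<in>S. p v = 0}"]) auto

lemma zariski_closure_subset:
  assumes "affine_variety n X" "S \<subseteq> X" shows "zariski_closure n S \<subseteq> X"
proof -
  obtain P where P: "P \<subseteq> poly_funs n" "X = {v \<in> carrier_vec n. \<forall>p\<in>P. p v = 0}"
    using assms(1) unfolding affine_variety_def by (elim exE conjE) (rule that)
  show ?thesis
  proof
    fix z assume z: "z \<in> zariski_closure n S"
    have "p z = 0" if p: "p \<in> P" for p
    proof -
      have "\<forall>v\<in>S. p v = 0" using assms(2) P(2) p by auto
      moreover have "p \<in> poly_funs n" using P(1) p by (rule subsetD)
      ultimately show ?thesis using z by (simp add: zariski_closure_def)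
    qed
    then show "z \<in> X" using z P(2) by (simp add: zariski_closure_def)
  qed
qed

lemma poly_funs_compose:
  assumes "p \<in> poly_funs N" and "\<And>i. i < N \<Longrightarrow> (\<lambda>v. \<phi> v $ i) \<in> poly_funs n"
  shows "(\<lambda>v. p (\<phi> v)) \<in> poly_funs n"
  using assms(1)
proof (induction rule: poly_funs.induct)
  case (coord i)
  then show ?case by (rule assms(2))
qed (rule poly_funs.const, (rule poly_funs.add poly_funs.mult; assumption)+)

text \<open>If two proper closed subsets covered the closure, each would have an equation whose
  pullback along \<open>\<phi>\<close> is not zero on \<open>L\<close>. The product of the pullbacks
  is nonzero somewhere on \<open>L\<close>, yet vanishes on the union.\<close>

lemma irreducible_image_closure:
  fixes L :: "'a::alg_closed_field vec set"
  assumes L: "line_closed n L" "L \<noteq> {}" and \<phi>: "\<And>i. i < N \<Longrightarrow> (\<lambda>v. \<phi> v $ i) \<in> poly_funs n"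
    and carrier: "\<phi> ` L \<subseteq> carrier_vec N"
  shows "irreducible_variety N (zariski_closure N (\<phi> ` L))"
  unfolding irreducible_variety_def
proof (intro conjI allI impI)
  show "affine_variety N (zariski_closure N (\<phi> ` L))" by (rule affine_variety_zariski_closure)
  show "zariski_closure N (\<phi> ` L) \<noteq> {}" using zariski_closure_superset[OF carrier] L by auto
next
  fix Z1 Z2
  let ?Z = "zariski_closure N (\<phi> ` L)"
  assume Z: "affine_variety N Z1 \<and> affine_variety N Z2 \<and> ?Z = Z1 \<union> Z2"
  have sep: "\<exists>p\<in>poly_funs N. (\<forall>z\<in>W. p z = 0) \<and> (\<exists>v\<in>L. p (\<phi> v) \<noteq> 0)"
    if W: "affine_variety N W" "\<not> ?Z \<subseteq> W" for W
  proof -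
    have "\<not> \<phi> ` L \<subseteq> W" using zariski_closure_subset[OF W(1)] W(2) by blast
    then obtain v where v: "v \<in> L" "\<phi> v \<notin> W" by blast
    then have "\<phi> v \<in> carrier_vec N" using carrier by auto
    obtain P where P: "P \<subseteq> poly_funs N" "W = {v \<in> carrier_vec N. \<forall>p\<in>P. p v = 0}"
      using W(1) unfolding affine_variety_def by (elim exE conjE) (rule that)
    with v \<open>\<phi> v \<in> carrier_vec N\<close> obtain p where "p \<in> P" "p (\<phi> v) \<noteq> 0" by auto
    then show ?thesis using P v(1) by (intro bexI[of _ p]) auto
  qed
  show "?Z = Z1 \<or> ?Z = Z2"
  proof (rule ccontr)
    assume "\<not> ?thesis"
    then have "\<not> ?Z \<subseteq> Z1" "\<not> ?Z \<subseteq> Z2" using Z by auto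
    then have "\<exists>p\<in>poly_funs N. (\<forall>z\<in>Z1. p z = 0) \<and> (\<exists>v\<in>L. p (\<phi> v) \<noteq> 0)"
      "\<exists>p\<in>poly_funs N. (\<forall>z\<in>Z2. p z = 0) \<and> (\<exists>v\<in>L. p (\<phi> v) \<noteq> 0)"
      using sep[of Z1] sep[of Z2] Z by simp_all
    then obtain p1 p2 where p1: "p1 \<in> poly_funs N" "\<forall>z\<in>Z1. p1 z = 0" "\<exists>v\<in>L. p1 (\<phi> v) \<noteq> 0"
      and p2: "p2 \<in> poly_funs N" "\<forall>z\<in>Z2. p2 z = 0" "\<exists>v\<in>L. p2 (\<phi> v) \<noteq> 0"
      by auto
    have "\<exists>v\<in>L. p1 (\<phi> v) * p2 (\<phi> v) \<noteq> 0"
      by (rule poly_funs_domain[OF L(1), where f = "\<lambda>v. p1 (\<phi> v)" and g = "\<lambda>v. p2 (\<phi> v)",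
            OF poly_funs_compose[OF p1(1) \<phi>] p1(3) poly_funs_compose[OF p2(1) \<phi>] p2(3)])
    then obtain v where v: "v \<in> L" "p1 (\<phi> v) * p2 (\<phi> v) \<noteq> 0" by blast
    have "\<phi> v \<in> Z1 \<union> Z2" using zariski_closure_superset[OF carrier] v Z by auto
    then show False using p1 p2 v by auto
  qed
qed

section \<open>Slice rank and geometric rank\<close>

text \<open>
  For fixed \<open>y\<close> the forms below are linear in \<open>x\<close>: the common zeros are parametrized by solving
  first for \<open>y\<close> over the constants and then for \<open>x\<close> over the polynomials in the parameters of \<open>y\<close>.
\<close>

lemma affine_bilinear_zero_chain:
  fixes X :: "'a::alg_closed_field vec set"
  assumes Q: "finite Q1" "finite Q2" and X: "affine_variety (n1 + n2) X"
    and sol: "\<And>v. v \<in> carrier_vec (n1 + n2) \<Longrightarrow>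
      (\<And>q. q \<in> Q1 \<Longrightarrow> (\<Sum>i<n1. (\<alpha> q i + (\<Sum>j<n2. \<beta> q i j * v $ (n1 + j))) * v $ i) = 0) \<Longrightarrow>
      (\<And>q. q \<in> Q2 \<Longrightarrow> (\<Sum>j<n2. c q j * v $ (n1 + j)) = 0) \<Longrightarrow> v \<in> X"
  shows "\<exists>D Z. n1 + n2 \<le> D + card Q1 + card Q2 \<and>
    (\<forall>i\<le>D. irreducible_variety (n1 + n2) (Z i) \<and> Z i \<subseteq> X) \<and> (\<forall>i<D. Z i \<subset> Z (Suc i))"
proof -
  let ?N = "n1 + n2"
  \<comment> \<open>First the constant equations in \<open>y\<close> alone: \<open>Y v\<close> is
    the solution whose parameters are the entries of \<open>v\<close> at the positions
    \<open>n1 + j\<close> with \<open>j\<close> in \<open>J0\<close>.\<close>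
  obtain J0 \<delta>0 w0 where J0: "J0 \<subseteq> {..<n2}" "n2 \<le> card J0 + card Q2" "\<delta>0 \<noteq> 0"
    and w0: "\<forall>j\<in>J0. \<forall>j'\<in>J0. w0 j j' = (if j = j' then \<delta>0 else 0)"
    and c0: "\<forall>q\<in>Q2. \<forall>j\<in>J0. (\<Sum>j'<n2. c q j' * w0 j j') = 0"
    using kernel_vectors[of Q2 "{..<n2}" c] Q by auto
  define Y where "Y v j' = (\<Sum>j\<in>J0. v $ (n1 + j) * w0 j j')" for v j'
  \<comment> \<open>The coefficient ring for solving in \<open>x\<close>: polynomial functions
    reading only the last \<open>n2\<close> coordinates, hence unaffected by the parameters of
    \<open>x\<close>.\<close>
  define R :: "('a vec \<Rightarrow> 'a) set" where "R = {f \<in> poly_funs ?N. \<forall>v w. (\<forall>j<n2. v $ (n1 + j) = w $ (n1 + j)) \<longrightarrow> f v = f w}"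
  have lc: "line_closed ?N (carrier_vec ?N)" by (auto simp: line_closed_def)
  have Rsum: "(\<lambda>v. \<Sum>i\<in>I. f i v) \<in> R" if "\<And>i. i \<in> I \<Longrightarrow> f i \<in> R" for I :: "nat set" and f
    using that by (auto simp: R_def intro!: poly_funs_sum sum.cong)
  have YR: "(\<lambda>v. Y v j') \<in> R" for j'
    unfolding Y_def
    by (intro Rsum) (use J0 in \<open>auto simp: R_def intro!: poly_funs.intros\<close>)
  have R_eq: "f v = f w" if "f \<in> R" "\<And>j. j < n2 \<Longrightarrow> v $ (n1 + j) = w $ (n1 + j)" for f v w
    using that by (auto simp: R_def)
  have Rpoly: "f \<in> poly_funs ?N" if "f \<in> R" for f using that by (simp add: R_def)
  have Rop: "(\<lambda>v. h (f v) (g v)) \<in> R"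
    if fg: "f \<in> R" "g \<in> R" and p: "(\<lambda>v. h (f v) (g v)) \<in> poly_funs ?N" for h f g
  proof -
    have "h (f v) (g v) = h (f w) (g w)" if "\<forall>j<n2. v $ (n1 + j) = w $ (n1 + j)" for v w
      using R_eq[OF fg(1), of v w] R_eq[OF fg(2), of v w] that by simp
    then show ?thesis using p by (simp add: R_def)
  qed
  have Radd: "(\<lambda>v. f v + g v) \<in> R" and Rdiff: "(\<lambda>v. f v - g v) \<in> R" and Rmult: "(\<lambda>v. f v * g v) \<in> R"
    if "f \<in> R" "g \<in> R" for f g
    using Rop[OF that poly_funs.add[OF that[THEN Rpoly]]] Rop[OF that poly_funs_diff[OF that[THEN Rpoly]]]
      Rop[OF that poly_funs.mult[OF that[THEN Rpoly]]] by auto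
  have Rconst: "(\<lambda>v. k) \<in> R" for k by (auto simp: R_def intro: poly_funs.intros)
  have "\<exists>J\<subseteq>{..<n1}. \<exists>\<delta>\<in>R. \<exists>w. card {..<n1} \<le> card J + card Q1 \<and>
    (\<exists>v\<in>carrier_vec ?N. \<delta> v \<noteq> 0) \<and> (\<forall>j\<in>J. \<forall>c\<in>{..<n1}. w j c \<in> R) \<and>
    (\<forall>j\<in>J. \<forall>j'\<in>J. \<forall>v. w j j' v = (if j = j' then \<delta> v else 0)) \<and>
    (\<forall>q\<in>Q1. \<forall>j\<in>J. \<forall>v\<in>carrier_vec ?N. (\<Sum>i<n1. (\<alpha> q i + (\<Sum>j'<n2. \<beta> q i j' * Y v j')) * w j i v) = 0)"
  proof (rule kernel_family[where M = "\<lambda>q i v. \<alpha> q i + (\<Sum>j'<n2. \<beta> q i j' * Y v j')"])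
    show "\<exists>v\<in>carrier_vec ?N. f v * g v \<noteq> 0"
      if "f \<in> R" "g \<in> R" "\<exists>v\<in>carrier_vec ?N. f v \<noteq> 0" "\<exists>v\<in>carrier_vec ?N. g v \<noteq> 0" for f g
      by (rule poly_funs_domain[OF lc Rpoly[OF that(1)] that(3) Rpoly[OF that(2)] that(4)])
    show "carrier_vec ?N \<noteq> ({} :: 'a vec set)" using zero_carrier_vec by blast
    show "(\<lambda>v. \<alpha> q i + (\<Sum>j'<n2. \<beta> q i j' * Y v j')) \<in> R" for q i
      by (intro Radd Rconst Rsum Rmult YR)
  qed (use Q in \<open>auto intro: Radd Rdiff Rmult Rconst\<close>)
  then obtain J \<delta> w v0 where J: "J \<subseteq> {..<n1}" "n1 \<le> card J + card Q1"
    and \<delta>R: "\<delta> \<in> R" and \<delta>: "v0 \<in> carrier_vec ?N" "\<delta> v0 \<noteq> 0"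
    and wR: "\<forall>j\<in>J. \<forall>c\<in>{..<n1}. w j c \<in> R"
    and wJ': "\<forall>j\<in>J. \<forall>j'\<in>J. \<forall>v. w j j' v = (if j = j' then \<delta> v else 0)"
    and wQ': "\<forall>q\<in>Q1. \<forall>j\<in>J. \<forall>v\<in>carrier_vec ?N.
      (\<Sum>i<n1. (\<alpha> q i + (\<Sum>j'<n2. \<beta> q i j' * Y v j')) * w j i v) = 0"
    unfolding card_lessThan by (elim exE bexE conjE) (rule that)
  have wJ: "w j j' v = (if j = j' then \<delta> v else 0)" if "j \<in> J" "j' \<in> J" for j j' v
    using wJ' that by blast
  have wQ: "(\<Sum>i<n1. (\<alpha> q i + (\<Sum>j'<n2. \<beta> q i j' * Y v j')) * w j i v) = 0"
    if "q \<in> Q1" "j \<in> J" "v \<in> carrier_vec ?N" for q j v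
    using wQ' that by blast
  have fin: "finite J" "finite J0" using J J0 finite_subset by auto
  \<comment> \<open>Each parameter sits at the position of the coordinate it controls. The diagonal
    blocks make \<open>\<phi>\<close> multiply a free coordinate of \<open>x\<close> by
    \<open>\<delta>\<close> and one of \<open>y\<close> by \<open>\<delta>0\<close>.\<close>
  define \<phi> where "\<phi> v = vec ?N (\<lambda>i. if i < n1 then \<Sum>j\<in>J. v $ j * w j i v else Y v (i - n1))" for v
  have \<phi>_carrier: "\<phi> v \<in> carrier_vec ?N" for v by (simp add: \<phi>_def)
  have \<phi>_x: "\<phi> v $ i = (\<Sum>j\<in>J. v $ j * w j i v)" if "i < n1" for v i using that by (simp add: \<phi>_def)
  have \<phi>_y: "\<phi> v $ (n1 + j) = Y v j" if "j < n2" for v j using that by (simp add: \<phi>_def)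
  have \<phi>_J: "\<phi> v $ j = v $ j * \<delta> v" if "j \<in> J" for v j
  proof -
    have "\<phi> v $ j = (\<Sum>i\<in>J. if i = j then v $ j * \<delta> v else 0)"
      using that J by (subst \<phi>_x) (auto simp: wJ intro!: sum.cong)
    then show ?thesis using that fin by simp
  qed
  have \<phi>_J0: "\<phi> v $ (n1 + j) = v $ (n1 + j) * \<delta>0" if "j \<in> J0" for v j
  proof -
    have "\<phi> v $ (n1 + j) = (\<Sum>i\<in>J0. if i = j then v $ (n1 + j) * \<delta>0 else 0)"
      using that J0 w0 by (subst \<phi>_y) (auto simp: Y_def intro!: sum.cong)
    then show ?thesis using that fin by simp
  qed
  have \<phi>_poly: "(\<lambda>v. \<phi> v $ i) \<in> poly_funs ?N" if "i < ?N" for i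
  proof (cases "i < n1")
    case True
    have "(\<lambda>v. \<Sum>j\<in>J. v $ j * w j i v) \<in> poly_funs ?N"
      using J wR True by (intro poly_funs_sum poly_funs.mult poly_funs.coord) (auto simp: R_def)
    then show ?thesis using True by (simp add: \<phi>_x)
  next
    case False
    then show ?thesis using YR[of "i - n1"] that \<phi>_y[of "i - n1"] by (simp add: R_def)
  qed
  have \<phi>_X: "\<phi> v \<in> X" if v: "v \<in> carrier_vec ?N" for v
  proof (rule sol[OF \<phi>_carrier])
    fix q assume q: "q \<in> Q1"
    define m where "m i = \<alpha> q i + (\<Sum>j'<n2. \<beta> q i j' * Y v j')" for i
    have "(\<Sum>i<n1. (\<alpha> q i + (\<Sum>j<n2. \<beta> q i j * \<phi> v $ (n1 + j))) * \<phi> v $ i) =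
      (\<Sum>i<n1. m i * (\<Sum>j\<in>J. v $ j * w j i v))"
      by (simp add: m_def \<phi>_x \<phi>_y)
    also have "\<dots> = (\<Sum>j\<in>J. v $ j * (\<Sum>i<n1. m i * w j i v))"
      unfolding sum_distrib_left by (subst sum.swap) (simp add: mult_ac)
    also have "\<dots> = 0" using wQ[OF q _ v] by (simp add: m_def)
    finally show "(\<Sum>i<n1. (\<alpha> q i + (\<Sum>j<n2. \<beta> q i j * \<phi> v $ (n1 + j))) * \<phi> v $ i) = 0" .
  next
    fix q assume q: "q \<in> Q2"
    have "(\<Sum>j<n2. c q j * \<phi> v $ (n1 + j)) = (\<Sum>j'<n2. c q j' * (\<Sum>j\<in>J0. v $ (n1 + j) * w0 j j'))"
      by (simp add: \<phi>_y Y_def)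
    also have "\<dots> = (\<Sum>j\<in>J0. v $ (n1 + j) * (\<Sum>j'<n2. c q j' * w0 j j'))"
      unfolding sum_distrib_left by (subst sum.swap) (simp add: mult_ac)
    also have "\<dots> = 0" using c0 q by simp
    finally show "(\<Sum>j<n2. c q j * \<phi> v $ (n1 + j)) = 0" .
  qed
  define js where "js = sorted_list_of_set J @ map ((+) n1) (sorted_list_of_set J0)"
  have js: "set js = J \<union> (+) n1 ` J0" "distinct js" "length js = card J + card J0"
    using fin J by (auto simp: js_def distinct_map)
  define D where "D = length js"
  \<comment> \<open>The base point has \<open>x = 0\<close> and takes \<open>y\<close> from
    \<open>v0\<close>; since \<open>\<delta>\<close> reads only the \<open>y\<close> part, it is
    nonzero at \<open>p\<close>. \<open>L k\<close> frees the first \<open>k\<close> parameters and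
    fixes all other coordinates as in \<open>p\<close>.\<close>
  define p where "p = vec ?N (\<lambda>i. if i < n1 then 0 else v0 $ i)"
  define L where "L k = {v \<in> carrier_vec ?N. \<forall>i<?N. i \<notin> set (take k js) \<longrightarrow> v $ i = p $ i}" for k
  define Z where "Z k = zariski_closure ?N (\<phi> ` L k)" for k
  have \<delta>_eq: "\<delta> v = \<delta> v'" if "\<And>j. j < n2 \<Longrightarrow> v $ (n1 + j) = v' $ (n1 + j)" for v v'
    by (rule R_eq[OF \<delta>R that])
  have "\<delta> p = \<delta> v0" by (rule \<delta>_eq) (simp add: p_def)
  then have \<delta>p: "\<delta> p \<noteq> 0" using \<delta> by simp
  have pL: "p \<in> L k" for k by (simp add: L_def p_def)
  have Lc: "L k \<subseteq> carrier_vec ?N" for k by (auto simp: L_def)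
  have irr: "irreducible_variety ?N (Z k)" for k
    unfolding Z_def
  proof (rule irreducible_image_closure[where n = ?N])
    show "line_closed ?N (L k)" by (auto simp: line_closed_def L_def)
    show "L k \<noteq> {}" using pL by blast
  qed (use \<phi>_poly \<phi>_carrier in auto)
  have ZX: "Z k \<subseteq> X" for k
    unfolding Z_def using \<phi>_X Lc by (intro zariski_closure_subset X) auto
  have strict: "Z k \<subset> Z (Suc k)" if k: "k < D" for k
  proof
    have "set (take k js) \<subseteq> set (take (Suc k) js)" by (rule set_take_subset_set_take) simp
    then have "L k \<subseteq> L (Suc k)" by (auto simp: L_def)
    then show "Z k \<subseteq> Z (Suc k)" unfolding Z_def by (intro zariski_closure_mono image_mono)
    define t where "t = js ! k"
    have t_new: "t \<notin> set (take k js)"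
      using js(2) k by (auto simp: t_def D_def in_set_conv_nth nth_eq_iff_index_eq)
    have t_in: "t \<in> set (take (Suc k) js)" using k by (simp add: t_def D_def take_Suc_conv_app_nth)
    have t: "t \<in> J \<or> (\<exists>j\<in>J0. t = n1 + j)" using js(1) k nth_mem[of k js] by (auto simp: t_def D_def)
    then have tN: "t < ?N" using J J0 by auto
    define v1 where "v1 = vec ?N (\<lambda>i. if i = t then p $ t + 1 else p $ i)"
    have v1: "v1 \<in> L (Suc k)" using t_in by (auto simp: L_def v1_def)
    \<comment> \<open>The constant value of coordinate \<open>t\<close> of \<open>\<phi>\<close> on
      \<open>L k\<close>: in an \<open>x\<close> direction it has the factor
      \<open>p $ t = 0\<close>. Passing from \<open>p\<close> to \<open>v1\<close> changes this
      coordinate by \<open>\<delta> p\<close> or \<open>\<delta>0\<close>, both nonzero.\<close>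
    define e where "e = (if t \<in> J then 0 else \<delta>0 * p $ t)"
    define f where "f z = z $ t - e" for z :: "'a vec"
    have f: "f \<in> poly_funs ?N"
      unfolding f_def using tN by (intro poly_funs_diff poly_funs.intros)
    have "f (\<phi> v) = 0" if "v \<in> L k" for v
    proof -
      have "v $ t = p $ t" using that t_new tN by (auto simp: L_def)
      moreover have "p $ t = 0" if "t \<in> J" using that J by (auto simp: p_def)
      ultimately show ?thesis using t by (auto simp: f_def e_def \<phi>_J \<phi>_J0)
    qed
    then have "f z = 0" if "z \<in> Z k" for z using that f by (auto simp: Z_def zariski_closure_def)
    moreover have "\<phi> v1 \<in> Z (Suc k)"
      unfolding Z_def using zariski_closure_superset[of "\<phi> ` L (Suc k)" ?N] v1 \<phi>_carrier by blast
    moreover have "f (\<phi> v1) \<noteq> 0"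
    proof (cases "t \<in> J")
      case True
      then have tn: "t < n1" using J by auto
      then have "\<delta> v1 = \<delta> p" by (intro \<delta>_eq) (simp add: v1_def)
      moreover have "v1 $ t = 1" using tn by (simp add: v1_def p_def)
      ultimately show ?thesis using True \<delta>p by (simp add: f_def e_def \<phi>_J)
    next
      case False
      then have "\<phi> v1 $ t = v1 $ t * \<delta>0" using t \<phi>_J0 by auto
      moreover have "v1 $ t = p $ t + 1" using tN by (simp add: v1_def)
      ultimately show ?thesis using False J0(3) by (simp add: f_def e_def algebra_simps)
    qed
    ultimately show "Z k \<noteq> Z (Suc k)" by blast
  qed
  have "n1 + n2 \<le> D + card Q1 + card Q2" using J(2) J0(2) js(3) by (simp add: D_def)
  then show ?thesis using irr ZX strict by (intro exI[of _ D] exI[of _ Z]) simp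
qed

section \<open>From slices to forms\<close>

lemma affine_variety_tensor_variety: "affine_variety (n1 + n2) (tensor_variety n1 n2 n3 T)"
proof -
  let ?f = "\<lambda>k v. \<Sum>i<n1. \<Sum>j<n2. T i j k * v $ i * v $ (n1 + j)"
  have "?f k \<in> poly_funs (n1 + n2)" for k
    by (intro poly_funs_sum poly_funs.mult poly_funs.const poly_funs.coord) auto
  then show ?thesis
    unfolding affine_variety_def
    by (intro exI[of _ "?f ` {..<n3}"]) (auto simp: tensor_variety_iff)
qed

text \<open>A contracted slice has a single form as a factor: \<open>u\<close> applied to
  \<open>x\<close> or to \<open>y\<close>, or, when \<open>u\<close> carries the third index, the
  bilinear form of \<open>V\<close>.\<close>

lemma slice_tensor_zeros:
  fixes S :: "'a::comm_ring_1 tensor"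
  assumes "slice_tensor n1 n2 n3 S"
  shows "(\<exists>c. \<forall>x y. (\<Sum>j<n2. c j * y j) = 0 \<longrightarrow> (\<forall>k<n3. (\<Sum>i<n1. \<Sum>j<n2. S i j k * x i * y j) = 0)) \<or>
    (\<exists>\<alpha> \<beta>. \<forall>x y. (\<Sum>i<n1. (\<alpha> i + (\<Sum>j<n2. \<beta> i j * y j)) * x i) = 0 \<longrightarrow>
      (\<forall>k<n3. (\<Sum>i<n1. \<Sum>j<n2. S i j k * x i * y j) = 0))"
  using assms unfolding slice_tensor_def
proof (elim disjE bexE)
  fix u V assume eq: "tensor_eq n1 n2 n3 S (\<lambda>i j k. u $ i * V $$ (j, k))"
  have "(\<Sum>i<n1. \<Sum>j<n2. S i j k * x i * y j) = (\<Sum>i<n1. u $ i * x i) * (\<Sum>j<n2. V $$ (j, k) * y j)"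
    if "k < n3" for x y k
    unfolding sum_product using eq that by (intro sum.cong refl) (simp add: tensor_eq_def mult_ac)
  then show ?thesis
    by (intro disjI2 exI[of _ "\<lambda>i. u $ i"] exI[of _ "\<lambda>i j. 0"]) simp
next
  fix u V assume eq: "tensor_eq n1 n2 n3 S (\<lambda>i j k. u $ j * V $$ (i, k))"
  have "(\<Sum>i<n1. \<Sum>j<n2. S i j k * x i * y j) = (\<Sum>i<n1. V $$ (i, k) * x i) * (\<Sum>j<n2. u $ j * y j)"
    if "k < n3" for x y k
    unfolding sum_product using eq that by (intro sum.cong refl) (simp add: tensor_eq_def mult_ac)
  then show ?thesis by (intro disjI1 exI[of _ "\<lambda>j. u $ j"]) simp
next
  fix u V assume eq: "tensor_eq n1 n2 n3 S (\<lambda>i j k. u $ k * V $$ (i, j))"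
  have "(\<Sum>i<n1. \<Sum>j<n2. S i j k * x i * y j) = u $ k * (\<Sum>i<n1. (0 + (\<Sum>j<n2. V $$ (i, j) * y j)) * x i)"
    if "k < n3" for x y k
    unfolding sum_distrib_left sum_distrib_right add_0
    using eq that by (intro sum.cong refl) (simp add: tensor_eq_def mult_ac)
  then show ?thesis
    by (intro disjI2 exI[of _ "\<lambda>i. 0"] exI[of _ "\<lambda>i j. V $$ (i, j)"]) simp
qed

lemma slice_decomposition_chain:
  fixes T :: "'a::alg_closed_field tensor"
  assumes S: "\<And>l. l < r \<Longrightarrow> slice_tensor n1 n2 n3 (S l)"
    and T: "tensor_eq n1 n2 n3 T (\<lambda>i j k. \<Sum>l<r. S l i j k)"
  shows "\<exists>D Z. n1 + n2 \<le> D + r \<and>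
    (\<forall>i\<le>D. irreducible_variety (n1 + n2) (Z i) \<and> Z i \<subseteq> tensor_variety n1 n2 n3 T) \<and>
    (\<forall>i<D. Z i \<subset> Z (Suc i))"
proof -
  let ?zero = "\<lambda>l x y. \<forall>k<n3. (\<Sum>i<n1. \<Sum>j<n2. S l i j k * x i * y j) = 0"
  let ?P = "\<lambda>l c. \<forall>x y. (\<Sum>j<n2. c j * y j) = 0 \<longrightarrow> ?zero l x y"
  let ?P' = "\<lambda>l \<alpha> \<beta>. \<forall>x y. (\<Sum>i<n1. (\<alpha> i + (\<Sum>j<n2. \<beta> i j * y j)) * x i) = 0 \<longrightarrow> ?zero l x y"
  \<comment> \<open>Slices killed by a linear form in \<open>y\<close> go to \<open>Q2\<close>, all
    others to \<open>Q1\<close>. A slice admitting both kinds is counted once, so the cardinalities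
    add up to \<open>r\<close>.\<close>
  define Q2 where "Q2 = {l. l < r \<and> (\<exists>c. ?P l c)}"
  define Q1 where "Q1 = {..<r} - Q2"
  have "\<forall>l\<in>Q2. \<exists>c. ?P l c" unfolding Q2_def by simp
  from bchoice[OF this] obtain c where c: "\<forall>l\<in>Q2. ?P l (c l)" ..
  have "\<forall>l\<in>Q1. \<exists>\<alpha> \<beta>. ?P' l \<alpha> \<beta>"
  proof
    fix l assume l: "l \<in> Q1"
    then have lr: "l < r" by (simp add: Q1_def)
    have n: "\<not> (\<exists>c. ?P l c)" using l by (simp add: Q1_def Q2_def)
    from slice_tensor_zeros[OF S[OF lr]] show "\<exists>\<alpha> \<beta>. ?P' l \<alpha> \<beta>"
    proof
      assume "\<exists>c. ?P l c"
      with n show ?thesis by contradiction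
    qed
  qed
  from bchoice[OF this] obtain \<alpha> where "\<forall>l\<in>Q1. \<exists>\<beta>. ?P' l (\<alpha> l) \<beta>" ..
  from bchoice[OF this] obtain \<beta> where \<alpha>\<beta>: "\<forall>l\<in>Q1. ?P' l (\<alpha> l) (\<beta> l)" ..
  have fin: "finite Q1" "finite Q2" unfolding Q1_def Q2_def by auto
  have "Q2 \<subseteq> {..<r}" unfolding Q2_def by auto
  then have card: "card Q1 + card Q2 = r"
    unfolding Q1_def using card_mono[of "{..<r}" Q2] by (simp add: card_Diff_subset finite_subset)
  have "\<exists>D Z. n1 + n2 \<le> D + card Q1 + card Q2 \<and>
    (\<forall>i\<le>D. irreducible_variety (n1 + n2) (Z i) \<and> Z i \<subseteq> tensor_variety n1 n2 n3 T) \<and>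
    (\<forall>i<D. Z i \<subset> Z (Suc i))"
  proof (rule affine_bilinear_zero_chain[OF fin affine_variety_tensor_variety, where \<alpha> = \<alpha> and \<beta> = \<beta> and c = c])
    fix v :: "'a vec"
    assume v: "v \<in> carrier_vec (n1 + n2)"
      and 1: "\<And>q. q \<in> Q1 \<Longrightarrow> (\<Sum>i<n1. (\<alpha> q i + (\<Sum>j<n2. \<beta> q i j * v $ (n1 + j))) * v $ i) = 0"
      and 2: "\<And>q. q \<in> Q2 \<Longrightarrow> (\<Sum>j<n2. c q j * v $ (n1 + j)) = 0"
    have zero: "?zero l (\<lambda>i. v $ i) (\<lambda>j. v $ (n1 + j))" if "l < r" for l
    proof (cases "l \<in> Q2")
      case True
      show ?thesis by (rule bspec[OF c True, THEN spec, THEN spec, THEN mp, OF 2[OF True]])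
    next
      case False
      then have l: "l \<in> Q1" using that by (simp add: Q1_def)
      show ?thesis by (rule bspec[OF \<alpha>\<beta> l, THEN spec, THEN spec, THEN mp, OF 1[OF l]])
    qed
    have "(\<Sum>i<n1. \<Sum>j<n2. T i j k * v $ i * v $ (n1 + j)) = 0" if k: "k < n3" for k
    proof -
      have "(\<Sum>i<n1. \<Sum>j<n2. T i j k * v $ i * v $ (n1 + j)) =
        (\<Sum>i<n1. \<Sum>j<n2. \<Sum>l<r. S l i j k * v $ i * v $ (n1 + j))"
        using T k by (intro sum.cong refl) (simp add: tensor_eq_def sum_distrib_right)
      also have "\<dots> = (\<Sum>i<n1. \<Sum>l<r. \<Sum>j<n2. S l i j k * v $ i * v $ (n1 + j))"
        by (rule sum.cong[OF refl], rule sum.swap)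
      also have "\<dots> = (\<Sum>l<r. \<Sum>i<n1. \<Sum>j<n2. S l i j k * v $ i * v $ (n1 + j))"
        by (rule sum.swap)
      also have "\<dots> = 0" using zero k by simp
      finally show ?thesis .
    qed
    then show "v \<in> tensor_variety n1 n2 n3 T" using v by (simp add: tensor_variety_iff)
  qed
  then show ?thesis using card by (simp add: add.assoc)
qed

text \<open>Cutting \<open>T\<close> along its first index gives \<open>n1\<close> slices, so the
  minimum defining the slice rank is attained.\<close>

lemma slice_decomposition_exists:
  "\<exists>r S. (\<forall>l<r. slice_tensor n1 n2 n3 (S l)) \<and> tensor_eq n1 n2 n3 T (\<lambda>i j k. \<Sum>l<(r::nat). S l i j k)"
proof (intro exI conjI allI impI)
  let ?S = "\<lambda>l i j k. unit_vec n1 l $ i * mat n2 n3 (\<lambda>(j, k). T l j k) $$ (j, k)"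
  show "slice_tensor n1 n2 n3 (?S l)" if "l < n1" for l
    unfolding slice_tensor_def
    by (intro disjI1 bexI[of _ "unit_vec n1 l"] bexI[of _ "mat n2 n3 (\<lambda>(j, k). T l j k)"])
       (auto simp: tensor_eq_def)
  show "tensor_eq n1 n2 n3 T (\<lambda>i j k. \<Sum>l<n1. ?S l i j k)"
    by (auto simp: tensor_eq_def unit_vec_def if_distrib[of "\<lambda>z. z * _"] cong: if_cong)
qed

theorem theorem4p1:
  fixes T :: "'a::alg_closed_field tensor" and n1 n2 n3 :: nat
  shows "int (subrank n1 n2 n3 T) \<le> geometric_rank n1 n2 n3 T \<and>
         geometric_rank n1 n2 n3 T \<le> int (slice_rank n1 n2 n3 T)"
proof
  let ?X = "tensor_variety n1 n2 n3 T"
  define Ds where "Ds = {d. \<exists>Z. (\<forall>i\<le>d. irreducible_variety (n1 + n2) (Z i) \<and> Z i \<subseteq> ?X) \<and>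
    (\<forall>i<d. Z i \<subset> Z (Suc i))}"
  have dim: "variety_dim (n1 + n2) ?X = Sup Ds" by (simp add: variety_dim_def Ds_def)
  let ?s = "\<lambda>s. tensor_le s s s unit_tensor n1 n2 n3 T"
  have bound: "d + s \<le> n1 + n2" if s: "?s s" and d: "d \<in> Ds" for s d
  proof -
    obtain Z where Z: "\<forall>i\<le>d. irreducible_variety (n1 + n2) (Z i) \<and> Z i \<subseteq> ?X"
      "\<forall>i<d. Z i \<subset> Z (Suc i)"
      using d unfolding Ds_def mem_Collect_eq by (elim exE conjE) (rule that)
    have "\<And>i. i \<le> d \<Longrightarrow> irreducible_variety (n1 + n2) (Z i)" "\<And>i. i < d \<Longrightarrow> Z i \<subset> Z (Suc i)"
      "Z d \<subseteq> ?X" using Z by simp_all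
    then show ?thesis by (rule unit_tensor_le_bounds(2)[OF s])
  qed
  \<comment> \<open>The empty unit tensor makes the set defining the subrank nonempty and bounds
    every chain length by \<open>n1 + n2\<close>.\<close>
  have zero: "?s 0"
    unfolding tensor_le_def
    by (intro bexI[of _ "0\<^sub>m 0 n1"] bexI[of _ "0\<^sub>m 0 n2"] bexI[of _ "0\<^sub>m 0 n3"]) (auto simp: tensor_eq_def)
  have bdd: "bdd_above Ds" using bound[OF zero] by (intro bdd_aboveI[of _ "n1 + n2"]) simp
  have "{s. ?s s} \<subseteq> {..n1}" using unit_tensor_le_bounds(1) by blast
  then have "finite {s. ?s s}" by (rule finite_subset) simp
  then have "subrank n1 n2 n3 T \<in> {s. ?s s}"
    unfolding subrank_def using zero by (intro Max_in) auto
  then have sub: "?s (subrank n1 n2 n3 T)" by simp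
  \<comment> \<open>On natural numbers the supremum of the empty set is 0, which settles the case
    without chains.\<close>
  have "Sup Ds \<le> n1 + n2 - subrank n1 n2 n3 T"
  proof (cases "Ds = {}")
    case False
    then show ?thesis using bound[OF sub] by (intro cSup_least) fastforce+
  qed (simp add: Sup_nat_def)
  then show "int (subrank n1 n2 n3 T) \<le> geometric_rank n1 n2 n3 T"
    using unit_tensor_le_bounds(1)[OF sub] by (simp add: geometric_rank_def dim)
  let ?r = "\<lambda>r. \<exists>S. (\<forall>l<r. slice_tensor n1 n2 n3 (S l)) \<and> tensor_eq n1 n2 n3 T (\<lambda>i j k. \<Sum>l<r. S l i j k)"
  have "?r (slice_rank n1 n2 n3 T)"
    unfolding slice_rank_def by (rule LeastI_ex[OF slice_decomposition_exists])
  then obtain S where S: "\<And>l. l < slice_rank n1 n2 n3 T \<Longrightarrow> slice_tensor n1 n2 n3 (S l)"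
    "tensor_eq n1 n2 n3 T (\<lambda>i j k. \<Sum>l<slice_rank n1 n2 n3 T. S l i j k)" by auto
  obtain d where "n1 + n2 \<le> d + slice_rank n1 n2 n3 T" "d \<in> Ds"
    using slice_decomposition_chain[OF S] unfolding Ds_def by auto
  moreover from this have "d \<le> Sup Ds" using bdd by (intro cSup_upper)
  ultimately show "geometric_rank n1 n2 n3 T \<le> int (slice_rank n1 n2 n3 T)"
    by (simp add: geometric_rank_def dim)
qed

end
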